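(* Assume $\alpha=\gamma$, let $k\ge 3$ be fixed, and let $X_{C_k}$ be the number of labeled copies of the cycle $C_k$ in $K(n,P)$. Then the threshold for the appearance of $C_k$ in $K(n,P)$ is $(\alpha+\beta)^k+(\alpha-\beta)^k=1$; that is, if $(\alpha+\beta)^k+(\alpha-\beta)^k<1$ then a.a.s. $K(n,P)$ contains no copy of $C_k$, and if $(\alpha+\beta)^k+(\alpha-\beta)^k>1$ then a.a.s. \[X_{C_k}=(1+o(1))\left((\alpha+\beta)^k+(\alpha-\beta)^k\right)^n .\]
   Context: Let $0<\alpha,\beta,\gamma<1$ be constants not depending on $n$, and $P=\begin{pmatrix}\alpha&\beta\\ \beta&\gamma\end{pmatrix}$ indexed by $\{0,1\}$ ($P_{1,1}=\alpha$, $P_{0,1}=P_{1,0}=\beta$, $P_{0,0}=\gamma$). The stochastic Kronecker graph $K(n,P)$ has vertex set $\mathbb Z_2^n$; writing $u_k$ for the $k$-th digit of $u$, each pair $\{u,v\}$ is an edge with probability $p_{u,v}=\prod_{k=1}^n P_{u_k,v_k}$, independently of all other pairs. A labeled copy of a graph $G$ is an injective map $\varphi:V(G)\to\mathbb Z_2^n$ mapping every edge of $G$ to an edge of $K(n,P)$. A.a.s. (asymptotically almost surely) means with probability tending to $1$ as $n\to\infty$. *)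

theory Defs
  imports "HOL-Probability.Probability"
begin

text \<open>The index set \<open>{0,1}\<close> of the initiator matrix is encoded as \<open>bool\<close>, with \<open>True\<close> for 1,
  and a vertex in \<open>(\<int>/2)\<^sup>n\<close> is the list of its \<open>n\<close> digits.\<close>

definition initiator :: "real \<Rightarrow> real \<Rightarrow> real \<Rightarrow> bool \<Rightarrow> bool \<Rightarrow> real" where
  "initiator \<alpha> \<beta> \<gamma> a b = (if a \<and> b then \<alpha> else if \<not> a \<and> \<not> b then \<gamma> else \<beta>)"

definition kron_vertices :: "nat \<Rightarrow> bool list set" where
  "kron_vertices n = {u. length u = n}"

definition kron_prob :: "nat \<Rightarrow> (bool \<Rightarrow> bool \<Rightarrow> real) \<Rightarrow> bool list \<Rightarrow> bool list \<Rightarrow> real" where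
  "kron_prob n P u v = (\<Prod>k<n. P (u ! k) (v ! k))"

definition vertex_pairs :: "'v set \<Rightarrow> 'v set set" where
  "vertex_pairs V = {{u, v} | u v. u \<in> V \<and> v \<in> V \<and> u \<noteq> v}"

text \<open>Edges are unordered pairs, so this is well defined only for symmetric \<open>P\<close>;
  see \<open>kron_pair_prob_insert\<close>.\<close>

definition kron_pair_prob :: "nat \<Rightarrow> (bool \<Rightarrow> bool \<Rightarrow> real) \<Rightarrow> bool list set \<Rightarrow> real" where
  "kron_pair_prob n P e = (THE p. \<exists>u v. e = {u, v} \<and> p = kron_prob n P u v)"

lemma initiator_commute: "initiator \<alpha> \<beta> \<gamma> a b = initiator \<alpha> \<beta> \<gamma> b a"
  by (auto simp: initiator_def)

lemma kron_pair_prob_insert: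
  assumes "\<And>a b. P a b = P b a"
  shows "kron_pair_prob n P {u, v} = kron_prob n P u v"
proof -
  have comm: "kron_prob n P x y = kron_prob n P y x" for x y
    unfolding kron_prob_def by (rule prod.cong) (auto intro: assms)
  show ?thesis
    unfolding kron_pair_prob_def
    by (rule the_equality) (auto simp: doubleton_eq_iff intro: comm)
qed

text \<open>The distribution of the edge set of \<open>K(n,P)\<close>.\<close>

definition kronecker_graph :: "nat \<Rightarrow> (bool \<Rightarrow> bool \<Rightarrow> real) \<Rightarrow> bool list set set pmf" where
  "kronecker_graph n P =
     map_pmf (\<lambda>\<omega>. {e \<in> vertex_pairs (kron_vertices n). \<omega> e})
       (Pi_pmf (vertex_pairs (kron_vertices n)) False
          (\<lambda>e. bernoulli_pmf (kron_pair_prob n P e)))"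

definition labeled_copies ::
  "'a set \<Rightarrow> 'a set set \<Rightarrow> 'b set \<Rightarrow> 'b set set \<Rightarrow> ('a \<Rightarrow> 'b) set" where
  "labeled_copies V\<^sub>G E\<^sub>G V\<^sub>H E\<^sub>H =
     {\<phi> \<in> V\<^sub>G \<rightarrow>\<^sub>E V\<^sub>H. inj_on \<phi> V\<^sub>G \<and> (\<forall>e\<in>E\<^sub>G. \<phi> ` e \<in> E\<^sub>H)}"

definition cycle_vertices :: "nat \<Rightarrow> nat set" where
  "cycle_vertices k = {..<k}"

definition cycle_edges :: "nat \<Rightarrow> nat set set" where
  "cycle_edges k = {{i, Suc i mod k} | i. i < k}"

definition cycle_copies :: "nat \<Rightarrow> nat \<Rightarrow> bool list set set \<Rightarrow> (nat \<Rightarrow> bool list) set" where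
  "cycle_copies k n E = labeled_copies (cycle_vertices k) (cycle_edges k) (kron_vertices n) E"

definition aas :: "(nat \<Rightarrow> 'a pmf) \<Rightarrow> (nat \<Rightarrow> 'a \<Rightarrow> bool) \<Rightarrow> bool" where
  "aas M Q \<longleftrightarrow> (\<lambda>n. measure_pmf.prob (M n) {\<omega>. Q n \<omega>}) \<longlonglongrightarrow> 1"

end

theory Submission
  imports Defs
begin

text \<open>
  Put \<open>s = \<alpha> + \<beta>\<close>, \<open>d = \<alpha> - \<beta>\<close> and \<open>\<lambda> = s ^ k + d ^ k\<close>, the trace of the \<open>k\<close>-th power of the initiator.
  The total weight of all closed \<open>k\<close>-walks on the vertices is exactly \<open>\<lambda> ^ n\<close>, because it factors over the
  \<open>n\<close> digits. Walks with a prescribed coincidence of two vertices contribute \<open>\<theta> ^ n\<close> with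
  \<open>\<theta> < \<lambda>\<close>, as digit patterns of positive weight are lost. Hence the expected number of cycles is at most
  \<open>\<lambda> ^ n\<close> and asymptotic to it, and the first moment method settles \<open>\<lambda> < 1\<close>.

  For \<open>\<lambda> > 1\<close> only pairs of cycles with a common edge contribute to the variance. Cauchy--Schwarz over the
  common part reduces to pairs that agree on a set \<open>I\<close> of \<open>j \<ge> 1\<close> edge positions, whose
  weight is again an \<open>n\<close>-th power, of the trace of a product of transfer matrices for two parallel walks. With
  \<open>l = k - j\<close> this trace is at most \<open>s ^ j * (s ^ (2 * l) + d ^ (2 * l)) / 2 + d ^ k * s ^ l\<close>, which is
  less than \<open>\<lambda>\<^sup>2\<close>, so Chebyshev's inequality applies.
\<close>

section \<open>Transfer matrices\<close>

text \<open>The entry \<open>(a, b)\<close> of the ordered product of the matrices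
  \<open>G 0\<close>, ..., \<open>G (m - 1)\<close>. The factor may vary with the position because
  shared and unshared edges of a pair of walks need different matrices.\<close>

fun transfer :: "(nat \<Rightarrow> 'a::finite \<Rightarrow> 'a \<Rightarrow> real) \<Rightarrow> nat \<Rightarrow> 'a \<Rightarrow> 'a \<Rightarrow> real" where
  "transfer G 0 a b = of_bool (a = b)"
| "transfer G (Suc m) a b = (\<Sum>c\<in>UNIV. transfer G m a c * G m c b)"

lemma sum_UNIV_eq_single:
  fixes f :: "'a::finite \<Rightarrow> real"
  assumes "\<And>x. x \<noteq> b \<Longrightarrow> f x = 0"
  shows "(\<Sum>x\<in>UNIV. f x) = f b"
  using sum.mono_neutral_right[of UNIV "{b}" f] assms by auto

lemma transfer_cong:
  "(\<And>i. i < m \<Longrightarrow> G i = H i) \<Longrightarrow> transfer G m a b = transfer H m a b"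
  by (induction m arbitrary: b) auto

lemma transfer_add:
  "transfer G (m + n) a b = (\<Sum>c\<in>UNIV. transfer G m a c * transfer (\<lambda>i. G (i + m)) n c b)"
proof (induction n arbitrary: b)
  case 0
  show ?case by (subst sum_UNIV_eq_single[of b]) auto
next
  case (Suc n)
  have "transfer G (m + Suc n) a b =
      (\<Sum>c\<in>UNIV. \<Sum>e\<in>UNIV. transfer G m a e * transfer (\<lambda>i. G (i + m)) n e c * G (n + m) c b)"
    by (simp add: Suc sum_distrib_right add.commute)
  also have "\<dots> = (\<Sum>e\<in>UNIV. \<Sum>c\<in>UNIV. transfer G m a e * transfer (\<lambda>i. G (i + m)) n e c * G (n + m) c b)"
    by (rule sum.swap)
  finally show ?case by (simp add: sum_distrib_left mult.assoc)
qed

text \<open>Cyclicity of the trace, tr(AB) = tr(BA), with A the first \<open>r\<close> factors and B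
  the other \<open>n\<close>. It serves to start a closed walk at a chosen position.\<close>

lemma trace_transfer_rotate:
  "(\<Sum>a\<in>UNIV. transfer G (r + n) a a) =
   (\<Sum>a\<in>UNIV. transfer (\<lambda>i. if i < n then G (i + r) else G (i - n)) (n + r) a a)"
proof -
  let ?H = "\<lambda>i. if i < n then G (i + r) else G (i - n)"
  have 1: "transfer ?H n a b = transfer (\<lambda>i. G (i + r)) n a b" for a b
    by (rule transfer_cong) auto
  have 2: "transfer (\<lambda>i. ?H (i + n)) r a b = transfer G r a b" for a b
    by (rule transfer_cong) auto
  have "(\<Sum>a\<in>UNIV. transfer G (r + n) a a) =
      (\<Sum>a\<in>UNIV. \<Sum>c\<in>UNIV. transfer G r a c * transfer (\<lambda>i. G (i + r)) n c a)"
    by (simp add: transfer_add)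
  also have "\<dots> = (\<Sum>c\<in>UNIV. \<Sum>a\<in>UNIV. transfer G r a c * transfer (\<lambda>i. G (i + r)) n c a)"
    by (rule sum.swap)
  also have "\<dots> = (\<Sum>c\<in>UNIV. transfer ?H (n + r) c c)"
    by (subst transfer_add) (simp only: 1 2 mult.commute)
  finally show ?thesis .
qed

lemma sum_PiE_Suc:
  fixes f :: "(nat \<Rightarrow> 'a::finite) \<Rightarrow> real"
  shows "(\<Sum>\<sigma>\<in>{..<Suc m} \<rightarrow>\<^sub>E UNIV. f \<sigma>) = (\<Sum>b\<in>UNIV. \<Sum>\<sigma>\<in>{..<m} \<rightarrow>\<^sub>E UNIV. f (\<sigma>(m := b)))"
proof -
  have eq: "{..<Suc m} \<rightarrow>\<^sub>E (UNIV::'a set) = (\<lambda>(y, g). g(m := y)) ` (UNIV \<times> ({..<m} \<rightarrow>\<^sub>E UNIV))"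
    by (simp add: lessThan_Suc PiE_insert_eq)
  have inj: "inj_on (\<lambda>(y, g). g(m := y)) (UNIV \<times> ({..<m} \<rightarrow>\<^sub>E (UNIV::'a set)))"
    by (rule inj_combinator) simp
  show ?thesis
    unfolding eq by (subst sum.reindex[OF inj]) (simp add: sum.cartesian_product case_prod_unfold)
qed

text \<open>Expanding a matrix product gives a sum over walks. The induction removes the last
  vertex; the indicators pin both end points so that the walk can later be closed or
  extended.\<close>

lemma path_sum_eq_transfer:
  "(\<Sum>\<sigma>\<in>{..<Suc m} \<rightarrow>\<^sub>E UNIV. of_bool (\<sigma> 0 = a) * of_bool (\<sigma> m = b) * (\<Prod>i<m. G i (\<sigma> i) (\<sigma> (Suc i))))
   = transfer G m a b"
proof (induction m arbitrary: b)
  case 0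
  have "(\<Sum>\<sigma>\<in>{..<Suc 0} \<rightarrow>\<^sub>E UNIV. of_bool (\<sigma> 0 = a) * of_bool (\<sigma> 0 = b) * (\<Prod>i<0. G i (\<sigma> i) (\<sigma> (Suc i))))
     = (\<Sum>c\<in>UNIV. of_bool (c = a) * of_bool (c = b) :: real)"
    by (subst sum_PiE_Suc) simp
  also have "\<dots> = of_bool (a = b)" by (subst sum_UNIV_eq_single[of b]) auto
  finally show ?case by simp
next
  case (Suc m)
  let ?P = "\<lambda>\<sigma>. \<Prod>i<m. G i (\<sigma> i) (\<sigma> (Suc i))"
  let ?S = "{..<Suc m} \<rightarrow>\<^sub>E (UNIV :: 'a set)"
  have upd: "?P (\<sigma>(Suc m := x)) = ?P \<sigma>" for \<sigma> and x :: 'a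
    by (rule prod.cong) auto
  have "(\<Sum>\<sigma>\<in>{..<Suc (Suc m)} \<rightarrow>\<^sub>E UNIV. of_bool (\<sigma> 0 = a) * of_bool (\<sigma> (Suc m) = b) *
            (\<Prod>i<Suc m. G i (\<sigma> i) (\<sigma> (Suc i)))) =
     (\<Sum>x\<in>UNIV. \<Sum>\<sigma>\<in>?S. of_bool (\<sigma> 0 = a) * of_bool (x = b) * (?P \<sigma> * G m (\<sigma> m) x))"
    by (subst sum_PiE_Suc) (simp add: upd)
  also have "\<dots> = (\<Sum>\<sigma>\<in>?S. \<Sum>x\<in>UNIV. of_bool (\<sigma> 0 = a) * of_bool (x = b) * (?P \<sigma> * G m (\<sigma> m) x))"
    by (rule sum.swap)
  also have "\<dots> = (\<Sum>\<sigma>\<in>?S. of_bool (\<sigma> 0 = a) * (?P \<sigma> * G m (\<sigma> m) b))"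
    by (intro sum.cong refl, subst sum_UNIV_eq_single[of b]) auto
  also have "\<dots> = (\<Sum>\<sigma>\<in>?S. \<Sum>c\<in>UNIV. of_bool (\<sigma> 0 = a) * of_bool (\<sigma> m = c) * ?P \<sigma> * G m c b)"
    by (intro sum.cong refl, subst sum_UNIV_eq_single[of "_ m"]) auto
  also have "\<dots> = (\<Sum>c\<in>UNIV. \<Sum>\<sigma>\<in>?S. of_bool (\<sigma> 0 = a) * of_bool (\<sigma> m = c) * ?P \<sigma> * G m c b)"
    by (rule sum.swap)
  finally show ?case by (simp add: Suc[symmetric] sum_distrib_right)
qed

lemma cycle_sum_eq_trace:
  assumes "k > 0"
  shows "(\<Sum>\<sigma>\<in>{..<k} \<rightarrow>\<^sub>E UNIV. \<Prod>i<k. G i (\<sigma> i) (\<sigma> (Suc i mod k))) = (\<Sum>a\<in>UNIV. transfer G k a a)"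
proof -
  obtain m where k: "k = Suc m" using assms gr0_implies_Suc by blast
  let ?S = "{..<Suc m} \<rightarrow>\<^sub>E (UNIV :: 'a set)"
  let ?P = "\<lambda>\<sigma>. \<Prod>i<m. G i (\<sigma> i) (\<sigma> (Suc i))"
  have "(\<Sum>\<sigma>\<in>{..<k} \<rightarrow>\<^sub>E UNIV. \<Prod>i<k. G i (\<sigma> i) (\<sigma> (Suc i mod k))) = (\<Sum>\<sigma>\<in>?S. ?P \<sigma> * G m (\<sigma> m) (\<sigma> 0))"
    unfolding k by (intro sum.cong refl) simp
  \<comment> \<open>Inserting indicators for the values of \<open>\<sigma> 0\<close> and
    \<open>\<sigma> m\<close> separates the closing edge from the open walk, whose sum is then an
    entry of \<open>transfer\<close>.\<close>
  also have "\<dots> = (\<Sum>\<sigma>\<in>?S. \<Sum>a\<in>UNIV. \<Sum>c\<in>UNIV. of_bool (\<sigma> 0 = a) * of_bool (\<sigma> m = c) * ?P \<sigma> * G m c a)"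
  proof (intro sum.cong refl)
    fix \<sigma>
    have "(\<Sum>a\<in>UNIV. \<Sum>c\<in>UNIV. of_bool (\<sigma> 0 = a) * of_bool (\<sigma> m = c) * ?P \<sigma> * G m c a) =
       (\<Sum>c\<in>UNIV. of_bool (\<sigma> m = c) * ?P \<sigma> * G m c (\<sigma> 0))"
      by (subst sum_UNIV_eq_single[of "\<sigma> 0"]) auto
    also have "\<dots> = ?P \<sigma> * G m (\<sigma> m) (\<sigma> 0)"
      by (subst sum_UNIV_eq_single[of "\<sigma> m"]) auto
    finally show "?P \<sigma> * G m (\<sigma> m) (\<sigma> 0) = (\<Sum>a\<in>UNIV. \<Sum>c\<in>UNIV. of_bool (\<sigma> 0 = a) * of_bool (\<sigma> m = c) * ?P \<sigma> * G m c a)" ..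
  qed
  also have "\<dots> = (\<Sum>a\<in>UNIV. \<Sum>\<sigma>\<in>?S. \<Sum>c\<in>UNIV. of_bool (\<sigma> 0 = a) * of_bool (\<sigma> m = c) * ?P \<sigma> * G m c a)"
    by (rule sum.swap)
  also have "\<dots> = (\<Sum>a\<in>UNIV. \<Sum>c\<in>UNIV. \<Sum>\<sigma>\<in>?S. of_bool (\<sigma> 0 = a) * of_bool (\<sigma> m = c) * ?P \<sigma> * G m c a)"
    by (intro sum.cong refl) (rule sum.swap)
  also have "\<dots> = (\<Sum>a\<in>UNIV. \<Sum>c\<in>UNIV. transfer G m a c * G m c a)"
    unfolding path_sum_eq_transfer[symmetric] sum_distrib_right ..
  finally show ?thesis by (simp add: k)
qed

text \<open>The vectors (1, 1) and (1, -1) are eigenvectors of the initiator with eigenvalues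
  \<alpha> + \<beta> and \<alpha> - \<beta>; \<open>plus\<close> and \<open>minus\<close> apply the
  \<open>m\<close>-th power to them.\<close>

lemma trace_transfer_initiator:
  "(\<Sum>a\<in>UNIV. transfer (\<lambda>_. initiator \<alpha> \<beta> \<alpha>) k a a) = (\<alpha> + \<beta>) ^ k + (\<alpha> - \<beta>) ^ k"
proof -
  let ?T = "transfer (\<lambda>_. initiator \<alpha> \<beta> \<alpha>)"
  have plus: "?T m a True + ?T m a False = (\<alpha> + \<beta>) ^ m" for m a
  proof (induction m)
    case (Suc m)
    have "?T (Suc m) a True + ?T (Suc m) a False = (\<alpha> + \<beta>) * (?T m a True + ?T m a False)"
      by (simp add: UNIV_bool initiator_def algebra_simps)
    with Suc show ?case by simp
  qed (auto simp: of_bool_def)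
  have minus: "?T m a True - ?T m a False = (if a then 1 else -1) * (\<alpha> - \<beta>) ^ m" for m a
  proof (induction m)
    case (Suc m)
    have "?T (Suc m) a True - ?T (Suc m) a False = (\<alpha> - \<beta>) * (?T m a True - ?T m a False)"
      by (simp add: UNIV_bool initiator_def algebra_simps)
    with Suc show ?case by simp
  qed (auto simp: of_bool_def)
  show ?thesis
    using plus[of k True] plus[of k False] minus[of k True] minus[of k False] by (simp add: UNIV_bool)
qed

text \<open>One step of two walks run in parallel. If \<open>t\<close> holds, the step is an edge shared by both cycles:
  the walks must coincide there and the edge is paid for only once.\<close>

definition pair_step :: "real \<Rightarrow> real \<Rightarrow> bool \<Rightarrow> bool \<times> bool \<Rightarrow> bool \<times> bool \<Rightarrow> real" where
  "pair_step \<alpha> \<beta> t x y =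
     (if t then of_bool (fst x = snd x \<and> fst y = snd y) * initiator \<alpha> \<beta> \<alpha> (fst x) (fst y)
      else initiator \<alpha> \<beta> \<alpha> (fst x) (fst y) * initiator \<alpha> \<beta> \<alpha> (snd x) (snd y))"

section \<open>Spectral bounds for two closed walks run in parallel\<close>

lemma sum_bool_pair: "(\<Sum>x\<in>UNIV. f x) = f (True, True) + f (False, False) + f (True, False) + (f (False, True) :: real)"
proof -
  have "(UNIV :: (bool \<times> bool) set) = {(True, True), (False, False), (True, False), (False, True)}"
    by auto
  then have "(\<Sum>x\<in>UNIV. f x) = sum f {(True, True), (False, False), (True, False), (False, True)}"
    by (rule arg_cong)
  then show ?thesis by simp
qed

lemma transfer_pair_step_diagonal:
  fixes \<alpha> \<beta> :: real and t :: "nat \<Rightarrow> bool"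
  assumes "0 \<le> \<alpha>" "0 \<le> \<beta>"
  defines "s \<equiv> \<alpha> + \<beta>" and "d \<equiv> \<alpha> - \<beta>"
  defines "T \<equiv> transfer (\<lambda>i. pair_step \<alpha> \<beta> (t i))"
  shows "T m (c, c) (c, c) \<le>
    ((\<Prod>i<m. if t i then s else s\<^sup>2) + (\<Prod>i<m. if t i then s else d\<^sup>2)) / 4
      + (\<Prod>i<m. if t i then d else s * d) / 2"
proof -
  \<comment> \<open>The characters of the four-element group diagonalise an unshared step:
    \<open>A + B + C\<close>, \<open>A + B - C\<close> and \<open>A - B\<close> are multiplied by \<open>s\<^sup>2\<close>, \<open>d\<^sup>2\<close> and \<open>s * d\<close>.
    A shared step kills \<open>C\<close>, so that the first two merge.\<close>
  define A B C where "A = (\<lambda>m. T m (c,c) (c,c))" "B = (\<lambda>m. T m (c,c) (\<not>c,\<not>c))"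
    "C = (\<lambda>m. T m (c,c) (True,False) + T m (c,c) (False,True))"
  define p q where "p = (\<lambda>m. \<Prod>i<m. if t i then s else s\<^sup>2)" "q = (\<lambda>m. \<Prod>i<m. if t i then s else d\<^sup>2)"
  have A0: "A 0 = 1" "B 0 = 0" "C 0 = 0" by (auto simp: A_B_C_def T_def)
  have step: "T (Suc m) x y = (\<Sum>z\<in>UNIV. T m x z * pair_step \<alpha> \<beta> (t m) z y)" for m x y
    by (simp add: T_def)
  have AS: "A (Suc m) = (if t m then \<alpha> * A m + \<beta> * B m else \<alpha>\<^sup>2 * A m + \<beta>\<^sup>2 * B m + \<alpha> * \<beta> * C m)" for m
    unfolding A_B_C_def step sum_bool_pair
    by (cases c; simp add: pair_step_def initiator_def power2_eq_square; simp add: algebra_simps)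
  have BS: "B (Suc m) = (if t m then \<beta> * A m + \<alpha> * B m else \<beta>\<^sup>2 * A m + \<alpha>\<^sup>2 * B m + \<alpha> * \<beta> * C m)" for m
    unfolding A_B_C_def step sum_bool_pair
    by (cases c; simp add: pair_step_def initiator_def power2_eq_square; simp add: algebra_simps)
  have CS: "C (Suc m) = (if t m then 0 else 2 * \<alpha> * \<beta> * (A m + B m) + (\<alpha>\<^sup>2 + \<beta>\<^sup>2) * C m)" for m
    unfolding A_B_C_def step sum_bool_pair
    by (cases c; simp add: pair_step_def initiator_def power2_eq_square; simp add: algebra_simps)
  have s0: "0 \<le> s" and ds: "d\<^sup>2 \<le> s\<^sup>2"
    using assms by (auto simp: s_def d_def power2_eq_square algebra_simps)
  \<comment> \<open>This is exact: at an unshared step \<open>C\<close> enters \<open>A\<close> and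
    \<open>B\<close> with the same coefficient and cancels.\<close>
  have minus: "A m - B m = (\<Prod>i<m. if t i then d else s * d)" for m
    by (induction m) (auto simp: A0 AS BS s_def d_def algebra_simps power2_eq_square)
  have pq: "0 \<le> q m \<and> q m \<le> p m" for m
    unfolding p_q_def using s0 ds by (auto intro!: prod_nonneg prod_mono)
  \<comment> \<open>The two inequalities support each other. At an unshared step the new
    \<open>A + B\<close> is a combination of the old total and the old \<open>A + B\<close> with
    nonnegative coefficients. At a shared step \<open>C\<close> vanishes, so the new total is
    \<open>s * (A + B)\<close>, and the second inequality together with \<open>q \<le> p\<close>
    restores the first.\<close>
  have inv: "A m + B m + C m \<le> p m \<and> 2 * (A m + B m) \<le> p m + q m" for m
  proof (induction m)
    case 0
    then show ?case by (simp add: A0 p_q_def)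
  next
    case (Suc m)
    show ?case
    proof (cases "t m")
      case True
      have e: "A (Suc m) + B (Suc m) = s * (A m + B m)" "C (Suc m) = 0" "p (Suc m) = s * p m" "q (Suc m) = s * q m"
        using True by (auto simp: AS BS CS s_def p_q_def algebra_simps)
      have "2 * (s * (A m + B m)) \<le> s * p m + s * q m"
        using mult_left_mono[OF conjunct2[OF Suc.IH] s0] by (simp add: algebra_simps)
      moreover have "s * q m \<le> s * p m" using pq[of m] s0 by (auto intro: mult_left_mono)
      ultimately show ?thesis unfolding e by linarith
    next
      case False
      have e: "A (Suc m) + B (Suc m) + C (Suc m) = s\<^sup>2 * (A m + B m + C m)"
        "2 * (A (Suc m) + B (Suc m)) = (s\<^sup>2 - d\<^sup>2) * (A m + B m + C m) + d\<^sup>2 * (2 * (A m + B m))"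
        "p (Suc m) = s\<^sup>2 * p m" "q (Suc m) = d\<^sup>2 * q m"
        using False by (auto simp: AS BS CS s_def d_def p_q_def algebra_simps power2_eq_square)
      have "(s\<^sup>2 - d\<^sup>2) * (A m + B m + C m) \<le> (s\<^sup>2 - d\<^sup>2) * p m"
        "d\<^sup>2 * (2 * (A m + B m)) \<le> d\<^sup>2 * (p m + q m)"
        "s\<^sup>2 * (A m + B m + C m) \<le> s\<^sup>2 * p m"
        using Suc.IH ds by (auto intro!: mult_left_mono)
      then show ?thesis unfolding e by (auto simp: algebra_simps)
    qed
  qed
  show ?thesis
    using minus[of m] inv[of m] unfolding A_B_C_def p_q_def by argo
qed

text \<open>A shared first step gives weight zero to every start at which the walks differ, so only
  the two diagonal states count in the trace. \<open>Suc m\<close> excludes the empty product, which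
  is the identity.\<close>

lemma transfer_pair_step_off_diagonal:
  assumes "t 0" "a \<noteq> b"
  shows "transfer (\<lambda>i. pair_step \<alpha> \<beta> (t i)) (Suc m) (a, b) x = 0"
proof (induction m arbitrary: x)
  case 0
  show ?case using assms by (cases a; cases b) (auto simp: sum_bool_pair pair_step_def)
next
  case (Suc m)
  show ?case by (subst transfer.simps(2)) (simp only: Suc mult_zero_left sum.neutral_const)
qed

lemma prod_if_power:
  fixes x y :: real
  shows "(\<Prod>i<k. if t i then x else y) = x ^ card {i. i < k \<and> t i} * y ^ (k - card {i. i < k \<and> t i})"
proof -
  have 1: "{..<k} \<inter> {i. t i} = {i. i < k \<and> t i}" by auto
  have 2: "{..<k} \<inter> - {i. t i} = {..<k} - {i. i < k \<and> t i}" by auto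
  have "card ({..<k} - {i. i < k \<and> t i}) = k - card {i. i < k \<and> t i}"
    by (subst card_Diff_subset) auto
  then show ?thesis
    by (subst prod.If_cases) (simp_all only: 1 2 prod_constant finite_lessThan)
qed

text \<open>The share of a single digit in the weight of two closed walks glued along the edge
  positions in \<open>I\<close>; its \<open>n\<close>-th power bounds the weight over all
  digits.\<close>

definition pair_cycle_sum :: "real \<Rightarrow> real \<Rightarrow> nat \<Rightarrow> nat set \<Rightarrow> real" where
  "pair_cycle_sum \<alpha> \<beta> k I =
     (\<Sum>\<sigma>\<in>{..<k} \<rightarrow>\<^sub>E UNIV. \<Prod>i<k. pair_step \<alpha> \<beta> (i \<in> I) (\<sigma> i) (\<sigma> (Suc i mod k)))"

lemma pair_cycle_sum_le:
  fixes \<alpha> \<beta> :: real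
  assumes "0 \<le> \<alpha>" "0 \<le> \<beta>" "I \<subseteq> {..<k}" "I \<noteq> {}"
  defines "s \<equiv> \<alpha> + \<beta>" and "d \<equiv> \<alpha> - \<beta>" and "j \<equiv> card I" and "l \<equiv> k - card I"
  shows "pair_cycle_sum \<alpha> \<beta> k I \<le> s ^ j * (s ^ (2 * l) + d ^ (2 * l)) / 2 + d ^ k * s ^ l"
proof -
  obtain r where r: "r \<in> I" using assms by blast
  with assms have rk: "r < k" by auto
  define n where "n = k - r"
  have k: "k = r + n" and n0: "n > 0" using rk by (auto simp: n_def)
  have jk: "j \<le> k" using assms card_mono[of "{..<k}" I] by auto
  \<comment> \<open>The indicator of \<open>I\<close> after a rotation that moves the shared
    position \<open>r\<close> to the front. This makes \<open>t 0\<close> true and leaves the number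
    of shared positions unchanged.\<close>
  define t where "t = (\<lambda>i. (if i < n then i + r else i - n) \<in> I)"
  have bij: "bij_betw (\<lambda>i. if i < n then i + r else i - n) {i. i < k \<and> t i} I"
    by (rule bij_betwI[of _ _ _ "\<lambda>i. if i < r then i + n else i - r"])
       (use assms in \<open>auto simp: t_def k split: if_splits\<close>)
  have card: "card {i. i < k \<and> t i} = j"
    using bij_betw_same_card[OF bij] by (simp add: j_def)
  let ?T = "transfer (\<lambda>i. pair_step \<alpha> \<beta> (t i)) k"
  let ?b = "(s ^ j * (s\<^sup>2) ^ l + s ^ j * (d\<^sup>2) ^ l) / 4 + d ^ j * (s * d) ^ l / 2"
  have "pair_cycle_sum \<alpha> \<beta> k I = (\<Sum>a\<in>UNIV. transfer (\<lambda>i. pair_step \<alpha> \<beta> (i \<in> I)) k a a)"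
    unfolding pair_cycle_sum_def using rk by (intro cycle_sum_eq_trace) auto
  also have "\<dots> = (\<Sum>a\<in>UNIV. transfer (\<lambda>i. if i < n then pair_step \<alpha> \<beta> (i + r \<in> I) else pair_step \<alpha> \<beta> (i - n \<in> I)) k a a)"
    unfolding k by (subst trace_transfer_rotate) (simp add: add.commute)
  also have "\<dots> = (\<Sum>a\<in>UNIV. ?T a a)"
    by (intro sum.cong refl transfer_cong) (auto simp: t_def)
  also have "\<dots> = ?T (True, True) (True, True) + ?T (False, False) (False, False)"
  proof -
    have "t 0" using r n0 by (simp add: t_def)
    moreover obtain m where "k = Suc m" using rk by (cases k) auto
    ultimately show ?thesis by (simp del: transfer.simps add: sum_bool_pair transfer_pair_step_off_diagonal)
  qed
  also have "\<dots> \<le> ?b + ?b"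
  proof -
    have "?T (c, c) (c, c) \<le> ?b" for c
      using transfer_pair_step_diagonal[OF assms(1,2), of t k c]
      unfolding prod_if_power card l_def j_def s_def[symmetric] d_def[symmetric] .
    then show ?thesis by (intro add_mono)
  qed
  also have "\<dots> = s ^ j * (s ^ (2 * l) + d ^ (2 * l)) / 2 + (d ^ j * d ^ l) * s ^ l"
    by (simp add: power_mult[symmetric] power_mult_distrib algebra_simps)
  also have "d ^ j * d ^ l = d ^ k"
    using jk by (simp add: l_def j_def power_add[symmetric])
  finally show ?thesis .
qed

section \<open>The bound for glued pairs lies below the square of the trace\<close>

lemma pair_exponent_bound_nonneg:
  fixes s d :: real
  assumes "0 \<le> s" "\<bar>d\<bar> \<le> s" "1 \<le> j" "0 \<le> d ^ (j + l)" "1 < s ^ (j + l) + d ^ (j + l)"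
  shows "s ^ j * (s ^ (2 * l) + d ^ (2 * l)) / 2 + d ^ (j + l) * s ^ l < (s ^ (j + l) + d ^ (j + l))\<^sup>2"
proof -
  let ?lam = "s ^ (j + l) + d ^ (j + l)"
  \<comment> \<open>Replacing \<open>d ^ (2 * l)\<close> by \<open>s ^ (2 * l)\<close> loses little
    here and lets the whole bound factor as \<open>s ^ l * ?lam\<close>.\<close>
  have "d ^ (2 * l) \<le> s ^ (2 * l)"
    using assms power_mono[of "\<bar>d\<bar>" s "2 * l"] by (simp add: power_even_abs)
  then have "s ^ j * (s ^ (2 * l) + d ^ (2 * l)) \<le> s ^ j * (2 * s ^ (2 * l))"
    using assms by (intro mult_left_mono) auto
  then have "s ^ j * (s ^ (2 * l) + d ^ (2 * l)) / 2 + d ^ (j + l) * s ^ l \<le> s ^ j * s ^ (2 * l) + d ^ (j + l) * s ^ l"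
    by simp
  also have "\<dots> = s ^ l * ?lam"
  proof -
    have "s ^ (2 * l) = s ^ l * s ^ l" by (simp add: mult_2 power_add)
    then show ?thesis by (simp add: power_add distrib_left mult_ac)
  qed
  \<comment> \<open>If \<open>s \<le> 1\<close>, then \<open>s ^ l\<close> is at most 1 and the
    hypothesis on \<open>?lam\<close> suffices; otherwise the exponent \<open>j + l\<close> is
    larger than \<open>l\<close>, since \<open>1 \<le> j\<close>, and the other term of
    \<open>?lam\<close> is nonnegative.\<close>
  also have "s ^ l < ?lam"
  proof (cases "s \<le> 1")
    case True
    then show ?thesis using assms power_le_one[of s l] by linarith
  next
    case False
    then have "s ^ l < s ^ (j + l)" using assms by (intro power_strict_increasing) auto
    then show ?thesis using assms by linarith
  qed
  then have "s ^ l * ?lam < ?lam * ?lam" using assms by (intro mult_strict_right_mono) auto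
  finally show ?thesis by (simp add: power2_eq_square)
qed

text \<open>Here the crude estimate used for \<open>d ^ k \<ge> 0\<close> fails: with \<open>a = 1 - c/k\<close>, \<open>s = 1 + c/k\<close> for suitable \<open>c\<close> and large \<open>k\<close> the bound
  \<open>(s ^ l + a ^ l) / 2\<close> on the contribution of the second cycle can exceed \<open>s ^ k - a ^ k\<close>,
  so the negative term has to be kept.\<close>

lemma pair_exponent_bound_odd:
  fixes s a :: real
  assumes "0 < a" "a < s" "a < 1" "1 \<le> j" "1 < s ^ (j + l) - a ^ (j + l)"
  shows "s ^ j * (s ^ (2 * l) + a ^ (2 * l)) / 2 - a ^ (j + l) * s ^ l < (s ^ (j + l) - a ^ (j + l))\<^sup>2"
proof -
  define p q m n where pq: "p = s ^ l" "q = a ^ l" "m = s ^ j" "n = a ^ j"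
  have s1: "1 < s"
  proof (rule ccontr)
    assume "\<not> 1 < s"
    then have "s ^ (j + l) \<le> 1" using assms by (intro power_le_one) auto
    moreover have "0 < a ^ (j + l)" using assms by simp
    ultimately show False using assms by linarith
  qed
  have b: "1 \<le> p" "0 < q" "q \<le> 1" "q \<le> p" "1 \<le> m" "0 < n" "n \<le> 1"
    unfolding pq using s1 assms by (auto intro: one_le_power power_le_one power_mono)
  define L where "L = p * m - q * n"
  have L: "s ^ (j + l) - a ^ (j + l) = L" "1 < L"
    using assms by (auto simp: L_def pq power_add algebra_simps)
  have ge: "p - q \<le> L"
  proof -
    have "p * 1 \<le> p * m" "q * n \<le> q * 1" using b by (auto intro!: mult_left_mono)
    then show ?thesis unfolding L_def by simp
  qed
  \<comment> \<open>The quantity is \<open>L\<^sup>2\<close> minus the left-hand side of the claim,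
    as the two identities after it show.\<close>
  have "0 < L * (L - (p + q) / 2) + q * (p - q) * (m + n) / 2"
  proof -
    have qq: "q * (p - q) * (m + n) / 2 \<ge> q * (p - q) / 2"
    proof -
      have "q * (p - q) * 1 \<le> q * (p - q) * (m + n)" using b by (intro mult_left_mono) auto
      then show ?thesis by simp
    qed
    have nn: "0 \<le> q * (p - q)" using b by auto
    \<comment> \<open>If \<open>L\<close> is at most \<open>(p + q) / 2\<close>, the first product
      must be bounded from below. The quadratic \<open>x * (x - (p + q) / 2)\<close> is at
      \<open>L\<close> no less than at any \<open>x \<le> L\<close> with
      \<open>x + L \<ge> (p + q) / 2\<close>. The choice is \<open>x = p - q\<close> when
      \<open>p\<close> is at least \<open>2 * q\<close>, and \<open>x = 1\<close> otherwise, where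
      \<open>p < 2 * q \<le> 2\<close>.\<close>
    consider "L > (p + q) / 2" | "L \<le> (p + q) / 2" "p \<ge> 2 * q" | "L \<le> (p + q) / 2" "p < 2 * q"
      by linarith
    then show ?thesis
    proof cases
      case 1
      then have "0 < L * (L - (p + q) / 2)" using L by simp
      then show ?thesis using qq nn by linarith
    next
      case 2
      have "(L - (p - q)) * (L + (p - q) - (p + q) / 2) \<ge> 0"
        using ge 2 b L by (intro mult_nonneg_nonneg) auto
      also have "(L - (p - q)) * (L + (p - q) - (p + q) / 2) =
          L * (L - (p + q) / 2) - (p - q) * ((p - q) - (p + q) / 2)"
        by (simp add: field_simps)
      finally have "L * (L - (p + q) / 2) \<ge> (p - q) * ((p - q) - (p + q) / 2)"
        by simp
      moreover have "(p - q) * ((p - q) - (p + q) / 2) + q * (p - q) * (m + n) / 2 > 0"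
      proof -
        have "(p - q) * ((p - q) - (p + q) / 2) + q * (p - q) * (m + n) / 2
            = (p - q) * ((p / 2 - q) + q * (m - 1 + n) / 2)" by (simp add: field_simps)
        moreover have "p - q > 0" using 2 b by linarith
        moreover have "q * (m - 1 + n) > 0" using b by (intro mult_pos_pos) auto
        ultimately show ?thesis using 2 by simp
      qed
      ultimately show ?thesis by linarith
    next
      case 3
      have "(L - 1) * (L + 1 - (p + q) / 2) > 0"
        using L 3 b by (intro mult_pos_pos) auto
      also have "(L - 1) * (L + 1 - (p + q) / 2) = L * (L - (p + q) / 2) - (1 - (p + q) / 2)"
        by (simp add: field_simps)
      finally have "L * (L - (p + q) / 2) > 1 - (p + q) / 2" by simp
      moreover have "1 - (p + q) / 2 + q * (p - q) / 2 \<ge> 0"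
      proof -
        have "1 - (p + q) / 2 + q * (p - q) / 2 = (1 - q) * (2 - q) / 2 + (1 - q) * (2 * q - p) / 2"
          by (simp add: field_simps)
        then show ?thesis using b 3 by simp
      qed
      ultimately show ?thesis using qq by linarith
    qed
  qed
  moreover have "s ^ j * (s ^ (2 * l) + a ^ (2 * l)) / 2 - a ^ (j + l) * s ^ l
      = L * (p + q) / 2 - q * (p - q) * (m + n) / 2"
  proof -
    have "s ^ (2 * l) = p * p" "a ^ (2 * l) = q * q" by (simp_all add: pq mult_2 power_add)
    moreover have "a ^ (j + l) = n * q" by (simp add: pq power_add)
    ultimately show ?thesis
      unfolding L_def pq(1,3)[symmetric] by (simp add: field_simps)
  qed
  moreover have "L * (L - (p + q) / 2) = L\<^sup>2 - L * (p + q) / 2"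
    by (simp add: power2_eq_square algebra_simps)
  ultimately show ?thesis unfolding L by linarith
qed

text \<open>The strict gap on which the second moment rests. A negative power of \<alpha> - \<beta>
  forces \<alpha> < \<beta> and \<open>k\<close> odd, and then \<open>a = \<beta> - \<alpha>\<close>
  meets the hypotheses of the odd bound.\<close>

lemma pair_cycle_sum_less:
  fixes \<alpha> \<beta> :: real
  assumes "0 < \<alpha>" "\<alpha> < 1" "0 < \<beta>" "\<beta> < 1" "I \<subseteq> {..<k}" "I \<noteq> {}"
    and "1 < (\<alpha> + \<beta>) ^ k + (\<alpha> - \<beta>) ^ k"
  shows "pair_cycle_sum \<alpha> \<beta> k I < ((\<alpha> + \<beta>) ^ k + (\<alpha> - \<beta>) ^ k)\<^sup>2"
proof -
  define j l where "j = card I" "l = k - card I"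
  have fin: "finite I" using assms finite_subset by blast
  have j1: "1 \<le> j" using assms fin by (simp add: j_l_def Suc_le_eq card_gt_0_iff)
  have k: "k = j + l" using assms card_mono[of "{..<k}" I] by (auto simp: j_l_def)
  have le: "pair_cycle_sum \<alpha> \<beta> k I \<le>
      (\<alpha> + \<beta>) ^ j * ((\<alpha> + \<beta>) ^ (2 * l) + (\<alpha> - \<beta>) ^ (2 * l)) / 2 + (\<alpha> - \<beta>) ^ k * (\<alpha> + \<beta>) ^ l"
    unfolding j_l_def using assms by (intro pair_cycle_sum_le) auto
  show ?thesis
  proof (cases "0 \<le> (\<alpha> - \<beta>) ^ k")
    case True
    have "\<bar>\<alpha> - \<beta>\<bar> \<le> \<alpha> + \<beta>" "0 \<le> \<alpha> + \<beta>" using assms by auto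
    from pair_exponent_bound_nonneg[OF this(2,1) j1, of l] True assms(7)
    show ?thesis using le unfolding k by linarith
  next
    case False
    then have neg: "\<alpha> < \<beta>" "odd k"
      using zero_le_power_eq[of "\<alpha> - \<beta>" k] by auto
    have e: "(\<alpha> - \<beta>) ^ k = - ((\<beta> - \<alpha>) ^ k)" "(\<alpha> - \<beta>) ^ (2 * l) = (\<beta> - \<alpha>) ^ (2 * l)"
      using neg power_minus_odd[of k "\<beta> - \<alpha>"] by (auto simp: power_mult power2_commute)
    have "0 < \<beta> - \<alpha>" "\<beta> - \<alpha> < \<alpha> + \<beta>" "\<beta> - \<alpha> < 1" using assms neg by auto
    from pair_exponent_bound_odd[OF this j1, of l] assms(7)
    have "(\<alpha> + \<beta>) ^ j * ((\<alpha> + \<beta>) ^ (2 * l) + (\<beta> - \<alpha>) ^ (2 * l)) / 2 - (\<beta> - \<alpha>) ^ k * (\<alpha> + \<beta>) ^ l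
        < ((\<alpha> + \<beta>) ^ k - (\<beta> - \<alpha>) ^ k)\<^sup>2"
      unfolding e k[symmetric] by simp
    with le show ?thesis unfolding e by simp
  qed
qed

section \<open>Factorisation over digits\<close>

text \<open>Splits the first digit off every vertex at once, for the induction on the number of
  digits.\<close>

lemma bij_betw_PiE_Cons:
  "bij_betw (\<lambda>(\<sigma>, \<phi>). \<lambda>i\<in>A. \<sigma> i # \<phi> i)
    ((A \<rightarrow>\<^sub>E UNIV) \<times> (A \<rightarrow>\<^sub>E {u. length u = n})) (A \<rightarrow>\<^sub>E {u. length u = Suc n})"
  (is "bij_betw ?h (?X \<times> ?Y) ?Z")
  unfolding bij_betw_def
proof
  show "inj_on ?h (?X \<times> ?Y)"
  proof (rule inj_onI, clarify)
    fix \<sigma> \<phi> \<sigma>' \<phi>'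
    assume H: "\<sigma> \<in> ?X" "\<phi> \<in> ?Y" "\<sigma>' \<in> ?X" "\<phi>' \<in> ?Y"
      and eq: "(\<lambda>i\<in>A. \<sigma> i # \<phi> i) = (\<lambda>i\<in>A. \<sigma>' i # \<phi>' i)"
    have "\<sigma> i = \<sigma>' i \<and> \<phi> i = \<phi>' i" if "i \<in> A" for i
      using fun_cong[OF eq, of i] that by simp
    then show "\<sigma> = \<sigma>' \<and> \<phi> = \<phi>'"
      using PiE_ext[OF H(1) H(3)] PiE_ext[OF H(2) H(4)] by blast
  qed
  show "?h ` (?X \<times> ?Y) = ?Z"
  proof (intro equalityI subsetI)
    fix y assume "y \<in> ?h ` (?X \<times> ?Y)"
    then show "y \<in> ?Z" by (auto simp: PiE_iff)
  next
    fix y assume y: "y \<in> ?Z"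
    let ?s = "\<lambda>i\<in>A. hd (y i)" and ?p = "\<lambda>i\<in>A. tl (y i)"
    have len: "length (y i) = Suc n" if "i \<in> A" for i using y that by (auto simp: PiE_iff)
    have "?h (?s, ?p) i = y i" for i
    proof (cases "i \<in> A")
      case True
      then show ?thesis using len[OF True] by (cases "y i") auto
    next
      case False
      then show ?thesis using PiE_arb[OF y False] by simp
    qed
    then have eq: "?h (?s, ?p) = y" by (rule ext)
    have "(?s, ?p) \<in> ?X \<times> ?Y" using len by (simp add: PiE_iff)
    then show "y \<in> ?h ` (?X \<times> ?Y)" by (rule image_eqI[where f = ?h and x = "(?s, ?p)", OF eq[symmetric]])
  qed
qed

text \<open>A map into words of length \<open>n\<close> amounts to \<open>n\<close> independent
  columns, one for each digit. A product of one function over the columns therefore sums to an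
  \<open>n\<close>-th power. The columns are restricted to \<open>A\<close> so that they are
  extensional.\<close>

lemma sum_PiE_lists:
  fixes f :: "('i \<Rightarrow> 'a::finite) \<Rightarrow> real"
  assumes "finite A"
  shows "(\<Sum>\<phi>\<in>A \<rightarrow>\<^sub>E {u. length u = n}. \<Prod>c<n. f (\<lambda>i\<in>A. \<phi> i ! c)) = (\<Sum>\<sigma>\<in>A \<rightarrow>\<^sub>E UNIV. f \<sigma>) ^ n"
proof (induction n)
  case 0
  have "A \<rightarrow>\<^sub>E {u :: 'a list. length u = 0} = {\<lambda>i\<in>A. []}"
    by (auto simp: PiE_def fun_eq_iff extensional_def Pi_def)
  then show ?case by simp
next
  case (Suc n)
  let ?L = "\<lambda>n. {u :: 'a list. length u = n}"
  let ?h = "\<lambda>(\<sigma>, \<phi>). \<lambda>i\<in>A. \<sigma> i # \<phi> i"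
  have bij: "bij_betw ?h ((A \<rightarrow>\<^sub>E UNIV) \<times> (A \<rightarrow>\<^sub>E ?L n)) (A \<rightarrow>\<^sub>E ?L (Suc n))"
    by (rule bij_betw_PiE_Cons)
  have "(\<Sum>\<phi>\<in>A \<rightarrow>\<^sub>E ?L (Suc n). \<Prod>c<Suc n. f (\<lambda>i\<in>A. \<phi> i ! c)) =
     (\<Sum>x\<in>(A \<rightarrow>\<^sub>E UNIV) \<times> (A \<rightarrow>\<^sub>E ?L n). \<Prod>c<Suc n. f (\<lambda>i\<in>A. ?h x i ! c))"
    by (rule sum.reindex_bij_betw[OF bij, symmetric])
  also have "\<dots> = (\<Sum>(\<sigma>, \<phi>)\<in>(A \<rightarrow>\<^sub>E UNIV) \<times> (A \<rightarrow>\<^sub>E ?L n). f \<sigma> * (\<Prod>c<n. f (\<lambda>i\<in>A. \<phi> i ! c)))"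
  proof (intro sum.cong refl)
    fix x assume x: "x \<in> (A \<rightarrow>\<^sub>E (UNIV :: 'a set)) \<times> (A \<rightarrow>\<^sub>E ?L n)"
    obtain \<sigma> \<phi> where xe: "x = (\<sigma>, \<phi>)" by (cases x)
    have "(\<lambda>i\<in>A. \<sigma> i) = \<sigma>" using x xe by (auto intro: PiE_restrict)
    then show "(\<Prod>c<Suc n. f (\<lambda>i\<in>A. ?h x i ! c)) = (case x of (\<sigma>, \<phi>) \<Rightarrow> f \<sigma> * (\<Prod>c<n. f (\<lambda>i\<in>A. \<phi> i ! c)))"
      by (simp add: xe prod.lessThan_Suc_shift del: prod.lessThan_Suc cong: restrict_cong)
  qed
  also have "\<dots> = (\<Sum>\<sigma>\<in>A \<rightarrow>\<^sub>E UNIV. f \<sigma>) * (\<Sum>\<phi>\<in>A \<rightarrow>\<^sub>E ?L n. \<Prod>c<n. f (\<lambda>i\<in>A. \<phi> i ! c))"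
    by (simp add: sum_product sum.cartesian_product)
  finally show ?case by (simp only: Suc power_Suc)
qed

text \<open>For an embedded cycle this is the probability that all its edges are present. It is
  defined for arbitrary maps because only the sum over all closed walks factors over the
  digits.\<close>

definition cycle_weight :: "nat \<Rightarrow> (bool \<Rightarrow> bool \<Rightarrow> real) \<Rightarrow> nat \<Rightarrow> (nat \<Rightarrow> bool list) \<Rightarrow> real" where
  "cycle_weight n P k \<phi> = (\<Prod>i<k. kron_prob n P (\<phi> i) (\<phi> (Suc i mod k)))"

lemma finite_kron_vertices: "finite (kron_vertices n)"
  using finite_lists_length_eq[of "UNIV :: bool set" n] by (simp add: kron_vertices_def)

lemma finite_cycle_maps: "finite ({..<k} \<rightarrow>\<^sub>E kron_vertices n)" for k :: nat
  by (intro finite_PiE finite_kron_vertices) auto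

lemma cycle_weight_eq_prod_digits:
  assumes "k > 0"
  shows "cycle_weight n P k \<phi> =
    (\<Prod>c<n. \<Prod>i<k. P ((\<lambda>i\<in>{..<k}. \<phi> i ! c) i) ((\<lambda>i\<in>{..<k}. \<phi> i ! c) (Suc i mod k)))"
  unfolding cycle_weight_def kron_prob_def
  using assms by (subst prod.swap) (intro prod.cong refl, auto)

lemma sum_cycle_weight:
  assumes "k > 0"
  shows "(\<Sum>\<phi>\<in>{..<k} \<rightarrow>\<^sub>E kron_vertices n. cycle_weight n (initiator \<alpha> \<beta> \<alpha>) k \<phi>) =
    ((\<alpha> + \<beta>) ^ k + (\<alpha> - \<beta>) ^ k) ^ n"
proof -
  have "(\<Sum>\<phi>\<in>{..<k} \<rightarrow>\<^sub>E kron_vertices n. cycle_weight n (initiator \<alpha> \<beta> \<alpha>) k \<phi>) =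
     (\<Sum>\<sigma>\<in>{..<k} \<rightarrow>\<^sub>E UNIV. \<Prod>i<k. initiator \<alpha> \<beta> \<alpha> (\<sigma> i) (\<sigma> (Suc i mod k))) ^ n"
    unfolding cycle_weight_eq_prod_digits[OF assms] kron_vertices_def
    by (rule sum_PiE_lists) simp
  also have "\<dots> = ((\<alpha> + \<beta>) ^ k + (\<alpha> - \<beta>) ^ k) ^ n"
    using cycle_sum_eq_trace[OF assms, of "\<lambda>_. initiator \<alpha> \<beta> \<alpha>"] trace_transfer_initiator[of \<alpha> \<beta> k] by simp
  finally show ?thesis .
qed

text \<open>Equality of two vertices is equality in every digit, so the sum still factors, but over
  fewer digit patterns. Positivity of the entries makes the loss strict, and the base \<theta> is
  the same for all \<open>n\<close>.\<close>

lemma sum_cycle_weight_collision: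
  assumes "i < k" "j < k" "i \<noteq> j" "0 < \<alpha>" "0 < \<beta>"
  shows "\<exists>\<theta>. 0 \<le> \<theta> \<and> \<theta> < (\<alpha> + \<beta>) ^ k + (\<alpha> - \<beta>) ^ k \<and>
    (\<forall>n. (\<Sum>\<phi>\<in>{\<phi> \<in> {..<k} \<rightarrow>\<^sub>E kron_vertices n. \<phi> i = \<phi> j}. cycle_weight n (initiator \<alpha> \<beta> \<alpha>) k \<phi>) \<le> \<theta> ^ n)"
proof -
  let ?P = "initiator \<alpha> \<beta> \<alpha>"
  let ?w = "\<lambda>\<sigma>. \<Prod>i<k. ?P (\<sigma> i) (\<sigma> (Suc i mod k))"
  define f where "f = (\<lambda>\<sigma>. of_bool (\<sigma> i = \<sigma> j) * ?w \<sigma>)"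
  define \<theta> where "\<theta> = (\<Sum>\<sigma>\<in>{..<k} \<rightarrow>\<^sub>E UNIV. f \<sigma>)"
  have Ppos: "0 < ?P a b" for a b using assms by (simp add: initiator_def)
  have wpos: "0 < ?w \<sigma>" for \<sigma> by (intro prod_pos) (simp add: Ppos)
  have \<theta>0: "0 \<le> \<theta>" unfolding \<theta>_def f_def using wpos by (intro sum_nonneg) (simp add: less_imp_le)
  have k0: "k > 0" using assms by auto
  have fnn: "0 \<le> f \<sigma>" for \<sigma> unfolding f_def using wpos[of \<sigma>] by simp
  have "\<theta> < (\<Sum>\<sigma>\<in>{..<k} \<rightarrow>\<^sub>E UNIV. ?w \<sigma>)"
    unfolding \<theta>_def
  proof (rule sum_strict_mono_ex1)
    show "finite ({..<k} \<rightarrow>\<^sub>E (UNIV :: bool set))" by (intro finite_PiE) auto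
    show "\<forall>\<sigma>\<in>{..<k} \<rightarrow>\<^sub>E UNIV. f \<sigma> \<le> ?w \<sigma>"
      unfolding f_def using wpos by (auto simp: less_imp_le)
    \<comment> \<open>The pattern that is true at \<open>i\<close> alone separates \<open>i\<close>
      from \<open>j\<close> and is one of those lost.\<close>
    have "f (\<lambda>l\<in>{..<k}. l = i) < ?w (\<lambda>l\<in>{..<k}. l = i)"
      unfolding f_def using assms wpos by auto
    then show "\<exists>\<sigma>\<in>{..<k} \<rightarrow>\<^sub>E UNIV. f \<sigma> < ?w \<sigma>"
      by (rule bexI[where x = "\<lambda>l\<in>{..<k}. l = i"]) simp
  qed
  then have \<theta>1: "\<theta> < (\<alpha> + \<beta>) ^ k + (\<alpha> - \<beta>) ^ k"
    using cycle_sum_eq_trace[OF k0, of "\<lambda>_. ?P"] trace_transfer_initiator[of \<alpha> \<beta> k] by simp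
  have "(\<Sum>\<phi>\<in>{\<phi> \<in> {..<k} \<rightarrow>\<^sub>E kron_vertices n. \<phi> i = \<phi> j}. cycle_weight n ?P k \<phi>) \<le> \<theta> ^ n" for n
  proof -
    have "(\<Sum>\<phi>\<in>{\<phi> \<in> {..<k} \<rightarrow>\<^sub>E kron_vertices n. \<phi> i = \<phi> j}. cycle_weight n ?P k \<phi>)
       = (\<Sum>\<phi>\<in>{\<phi> \<in> {..<k} \<rightarrow>\<^sub>E kron_vertices n. \<phi> i = \<phi> j}. \<Prod>c<n. f (\<lambda>i\<in>{..<k}. \<phi> i ! c))"
      unfolding f_def prod.distrib cycle_weight_eq_prod_digits[OF k0] using assms
      by (intro sum.cong refl) auto
    also have "\<dots> \<le> (\<Sum>\<phi>\<in>{..<k} \<rightarrow>\<^sub>E kron_vertices n. \<Prod>c<n. f (\<lambda>i\<in>{..<k}. \<phi> i ! c))"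
      by (intro sum_mono2 finite_cycle_maps prod_nonneg ballI fnn) auto
    also have "\<dots> = \<theta> ^ n"
      unfolding kron_vertices_def \<theta>_def by (rule sum_PiE_lists) simp
    finally show ?thesis .
  qed
  with \<theta>0 \<theta>1 show ?thesis by (intro exI[of _ \<theta>]) simp
qed

definition agree_on_edges :: "nat \<Rightarrow> nat set \<Rightarrow> (nat \<Rightarrow> 'a) \<Rightarrow> (nat \<Rightarrow> 'a) \<Rightarrow> bool" where
  "agree_on_edges k I \<phi> \<psi> \<longleftrightarrow> (\<forall>i\<in>I. \<phi> i = \<psi> i \<and> \<phi> (Suc i mod k) = \<psi> (Suc i mod k))"

text \<open>Zipping the two maps digit by digit gives one map into words over pairs of digits, to
  which \<open>sum_PiE_lists\<close> applies. For agreeing pairs the indicators in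
  \<open>pair_step\<close> are all 1; enlarging the range to all such words adds only nonnegative
  terms.\<close>

lemma sum_agreeing_pairs_le:
  assumes "k > 0" "0 \<le> \<alpha>" "0 \<le> \<beta>" and I: "I \<subseteq> {..<k}"
  defines "P \<equiv> initiator \<alpha> \<beta> \<alpha>"
  defines "q \<equiv> \<lambda>n \<phi> i. kron_prob n P (\<phi> i) (\<phi> (Suc i mod k))"
  shows "(\<Sum>(\<phi>, \<psi>)\<in>{(\<phi>, \<psi>). \<phi> \<in> {..<k} \<rightarrow>\<^sub>E kron_vertices n \<and> \<psi> \<in> {..<k} \<rightarrow>\<^sub>E kron_vertices n \<and> agree_on_edges k I \<phi> \<psi>}.
      \<Prod>i<k. if i \<in> I then q n \<phi> i else q n \<phi> i * q n \<psi> i) \<le> pair_cycle_sum \<alpha> \<beta> k I ^ n"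
proof -
  let ?M = "{..<k} \<rightarrow>\<^sub>E kron_vertices n"
  let ?S = "{(\<phi>, \<psi>). \<phi> \<in> ?M \<and> \<psi> \<in> ?M \<and> agree_on_edges k I \<phi> \<psi>}"
  let ?Z = "{..<k} \<rightarrow>\<^sub>E {u :: (bool \<times> bool) list. length u = n}"
  let ?g = "\<lambda>(\<phi>, \<psi>). \<lambda>i\<in>{..<k}. zip (\<phi> i) (\<psi> i)"
  define f where "f = (\<lambda>\<sigma>. \<Prod>i<k. pair_step \<alpha> \<beta> (i \<in> I) (\<sigma> i) (\<sigma> (Suc i mod k)))"
  have fnn: "0 \<le> f \<sigma>" for \<sigma>
    unfolding f_def using assms by (intro prod_nonneg) (auto simp: pair_step_def initiator_def)
  have len: "length (\<phi> i) = n" if "\<phi> \<in> ?M" "i < k" for \<phi> i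
    using that by (auto simp: kron_vertices_def PiE_iff)
  have inj: "inj_on ?g ?S"
  proof (rule inj_onI, clarify)
    fix a b c d assume H: "a \<in> ?M" "b \<in> ?M" "c \<in> ?M" "d \<in> ?M"
      and eq: "(\<lambda>i\<in>{..<k}. zip (a i) (b i)) = (\<lambda>i\<in>{..<k}. zip (c i) (d i))"
    have z: "zip (a i) (b i) = zip (c i) (d i)" if "i < k" for i
      using fun_cong[OF eq, of i] that by simp
    have "a i = c i \<and> b i = d i" if "i < k" for i
      using z[OF that] len[OF H(1) that] len[OF H(2) that] len[OF H(3) that] len[OF H(4) that]
      by (metis map_fst_zip map_snd_zip)
    then show "a = c \<and> b = d"
      using PiE_ext[OF H(1) H(3)] PiE_ext[OF H(2) H(4)] by auto
  qed
  have summand: "(\<Prod>i<k. if i \<in> I then q n \<phi> i else q n \<phi> i * q n \<psi> i) = (\<Prod>c<n. f (\<lambda>i\<in>{..<k}. ?g (\<phi>, \<psi>) i ! c))"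
    if S: "(\<phi>, \<psi>) \<in> ?S" for \<phi> \<psi>
  proof -
    have "(\<Prod>c<n. f (\<lambda>i\<in>{..<k}. ?g (\<phi>, \<psi>) i ! c)) =
      (\<Prod>i<k. \<Prod>c<n. pair_step \<alpha> \<beta> (i \<in> I) (\<phi> i ! c, \<psi> i ! c) (\<phi> (Suc i mod k) ! c, \<psi> (Suc i mod k) ! c))"
      unfolding f_def using S len assms(1)
      by (subst prod.swap) (intro prod.cong refl, auto)
    also have "\<dots> = (\<Prod>i<k. if i \<in> I then q n \<phi> i else q n \<phi> i * q n \<psi> i)"
      using S by (intro prod.cong refl)
        (auto simp: q_def kron_prob_def pair_step_def P_def prod.distrib agree_on_edges_def)
    finally show ?thesis by simp
  qed
  have "(\<Sum>(\<phi>, \<psi>)\<in>?S. \<Prod>i<k. if i \<in> I then q n \<phi> i else q n \<phi> i * q n \<psi> i)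
      = (\<Sum>x\<in>?S. \<Prod>c<n. f (\<lambda>i\<in>{..<k}. ?g x i ! c))"
    using summand by (intro sum.cong refl) (auto split: prod.splits)
  also have "\<dots> = (\<Sum>\<xi>\<in>?g ` ?S. \<Prod>c<n. f (\<lambda>i\<in>{..<k}. \<xi> i ! c))"
    by (subst sum.reindex[OF inj]) simp
  also have "\<dots> \<le> (\<Sum>\<xi>\<in>?Z. \<Prod>c<n. f (\<lambda>i\<in>{..<k}. \<xi> i ! c))"
  proof (intro sum_mono2 prod_nonneg ballI fnn)
    have "finite {u :: (bool \<times> bool) list. length u = n}"
      using finite_lists_length_eq[of "UNIV :: (bool \<times> bool) set" n] by simp
    then show "finite ?Z" by (intro finite_PiE) auto
    show "?g ` ?S \<subseteq> ?Z"
    proof (rule image_subsetI)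
      fix x assume "x \<in> ?S"
      then obtain \<phi> \<psi> where x: "x = (\<phi>, \<psi>)" "\<phi> \<in> ?M" "\<psi> \<in> ?M" by blast
      have "(\<lambda>i\<in>{..<k}. zip (\<phi> i) (\<psi> i)) \<in> ?Z"
        using len[OF x(2)] len[OF x(3)] by (intro restrict_PiE_iff[THEN iffD2]) simp
      then show "?g x \<in> ?Z" by (simp only: x(1) prod.case)
    qed
  qed
  also have "\<dots> = pair_cycle_sum \<alpha> \<beta> k I ^ n"
    unfolding pair_cycle_sum_def f_def[symmetric] by (rule sum_PiE_lists[where f = f]) simp
  finally show ?thesis .
qed

section \<open>Pairs of cycles with a common edge\<close>

text \<open>Cauchy--Schwarz for the sums over the fibres of \<open>h\<close>, of which there are at
  most \<open>K\<close>.\<close>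

lemma sum_square_le_card_image:
  fixes a :: "'x \<Rightarrow> real"
  assumes "finite A" "\<And>x. x \<in> A \<Longrightarrow> 0 \<le> a x" "card (h ` A) \<le> K"
  shows "(\<Sum>x\<in>A. a x)\<^sup>2 \<le> K * (\<Sum>(x, y)\<in>{(x, y). x \<in> A \<and> y \<in> A \<and> h x = h y}. a x * a y)"
proof -
  let ?F = "\<lambda>b. {x \<in> A. h x = b}"
  have "(\<Sum>x\<in>A. a x)\<^sup>2 = (\<Sum>b\<in>h ` A. \<Sum>x\<in>?F b. a x)\<^sup>2"
    by (subst sum.image_gen[OF assms(1), of _ h]) simp
  also have "\<dots> \<le> (\<Sum>b\<in>h ` A. (\<Sum>x\<in>?F b. a x)\<^sup>2) * card (h ` A)"
    by (rule sum_squared_le_sum_of_squares)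
  also have "\<dots> \<le> (\<Sum>b\<in>h ` A. (\<Sum>x\<in>?F b. a x)\<^sup>2) * K"
    using assms by (intro mult_left_mono sum_nonneg) auto
  also have "(\<Sum>b\<in>h ` A. (\<Sum>x\<in>?F b. a x)\<^sup>2) = (\<Sum>b\<in>h ` A. \<Sum>(x, y)\<in>?F b \<times> ?F b. a x * a y)"
    by (simp add: power2_eq_square sum_product sum.cartesian_product)
  also have "\<dots> = (\<Sum>(b, x, y)\<in>(SIGMA b:h ` A. ?F b \<times> ?F b). a x * a y)"
    using assms by (subst sum.Sigma) (auto simp: case_prod_unfold)
  also have "\<dots> = (\<Sum>(x, y)\<in>{(x, y). x \<in> A \<and> y \<in> A \<and> h x = h y}. a x * a y)"
    by (rule sum.reindex_bij_witness[where i = "\<lambda>(x, y). (h x, x, y)" and j = snd]) auto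
  finally show ?thesis by (simp add: mult.commute)
qed

definition cycle_edge :: "nat \<Rightarrow> (nat \<Rightarrow> 'v) \<Rightarrow> nat \<Rightarrow> 'v set" where
  "cycle_edge k \<phi> i = {\<phi> i, \<phi> (Suc i mod k)}"

lemma Suc_mod_neq: "i < k \<Longrightarrow> 2 \<le> k \<Longrightarrow> Suc i mod k \<noteq> i"
  by (cases "Suc i = k") auto

text \<open>Equal edges at different positions would be traversed in opposite directions, so that
  \<open>i\<close> and \<open>i + 2\<close> agree modulo \<open>k\<close>; this is impossible for
  \<open>k \<ge> 3\<close>.\<close>

lemma inj_on_cycle_edge:
  assumes "inj_on \<phi> {..<k}" "3 \<le> k"
  shows "inj_on (cycle_edge k \<phi>) {..<k}"
proof (rule inj_onI)
  fix i j assume ij: "i \<in> {..<k}" "j \<in> {..<k}" and eq: "cycle_edge k \<phi> i = cycle_edge k \<phi> j"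
  have "\<phi> ` {i, Suc i mod k} = \<phi> ` {j, Suc j mod k}" using eq by (simp add: cycle_edge_def)
  moreover have "{i, Suc i mod k} \<subseteq> {..<k}" "{j, Suc j mod k} \<subseteq> {..<k}" using ij assms(2) by auto
  ultimately have "{i, Suc i mod k} = {j, Suc j mod k}" using inj_on_image_eq_iff[OF assms(1)] by blast
  then consider "i = j" | "i = Suc j mod k" "j = Suc i mod k" by (auto simp: doubleton_eq_iff)
  then show "i = j"
  proof cases
    case 2
    have "Suc l mod k = (if Suc l = k then 0 else Suc l)" if "l < k" for l
      using that by simp
    then show ?thesis using 2 ij assms(2) by (simp split: if_splits)
  qed
qed

text \<open>Group the pairs by their set \<open>S\<close> of common edges; the two cycles are then independent given \<open>S\<close>, and
  splitting the cycles through \<open>S\<close> according to where they meet the vertices of \<open>S\<close> (at most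
  \<open>(k + 1) ^ k\<close> ways) reduces everything, by Cauchy--Schwarz, to pairs that share the edges of \<open>S\<close>
  in the same positions.\<close>

lemma sum_overlapping_pairs_le:
  fixes p :: "'v set \<Rightarrow> real"
  assumes k: "3 \<le> k" and pos: "\<And>e. 0 < p e" and fin: "finite \<Phi>"
    and inj: "\<And>\<phi>. \<phi> \<in> \<Phi> \<Longrightarrow> inj_on \<phi> {..<k}"
  defines "ES \<equiv> \<lambda>\<phi>. cycle_edge k \<phi> ` {..<k}"
  defines "T \<equiv> \<lambda>I \<phi> \<psi>. \<Prod>i<k. if i \<in> I then p (cycle_edge k \<phi> i) else p (cycle_edge k \<phi> i) * p (cycle_edge k \<psi> i)"
  shows "(\<Sum>(\<phi>, \<psi>)\<in>{(\<phi>, \<psi>). \<phi> \<in> \<Phi> \<and> \<psi> \<in> \<Phi> \<and> ES \<phi> \<inter> ES \<psi> \<noteq> {}}. \<Prod>e\<in>ES \<phi> \<union> ES \<psi>. p e)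
    \<le> real ((k + 1) ^ k) *
      (\<Sum>I\<in>Pow {..<k} - {{}}. \<Sum>(\<phi>, \<psi>)\<in>{(\<phi>, \<psi>). \<phi> \<in> \<Phi> \<and> \<psi> \<in> \<Phi> \<and> agree_on_edges k I \<phi> \<psi>}. T I \<phi> \<psi>)"
proof -
  define R where "R = {(\<phi>, \<psi>). \<phi> \<in> \<Phi> \<and> \<psi> \<in> \<Phi> \<and> ES \<phi> \<inter> ES \<psi> \<noteq> {}}"
  define J where "J = (\<lambda>(\<phi>, \<psi>). ES \<phi> \<inter> ES \<psi>)"
  define g where "g = (\<lambda>(\<phi>, \<psi>). \<Prod>e\<in>ES \<phi> \<union> ES \<psi>. p e)"
  define w where "w = (\<lambda>S. \<Prod>e\<in>S. p e)"
  define F where "F = (\<lambda>S. {\<phi> \<in> \<Phi>. S \<subseteq> ES \<phi>})"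
  \<comment> \<open>\<open>h S \<phi>\<close> records at which positions \<phi> visits which
    vertices of \<open>S\<close> and forgets everything else. Cycles with equal records pass through
    the edges of \<open>S\<close> at the same positions.\<close>
  define h :: "'v set set \<Rightarrow> (nat \<Rightarrow> 'v) \<Rightarrow> nat \<Rightarrow> 'v option" where "h = (\<lambda>S \<phi>. \<lambda>i\<in>{..<k}. if \<phi> i \<in> \<Union>S then Some (\<phi> i) else None)"
  define A where "A = (\<lambda>S. {(\<phi>, \<psi>). \<phi> \<in> F S \<and> \<psi> \<in> F S \<and> h S \<phi> = h S \<psi>})"
  define B where "B = (\<lambda>I. {(\<phi>, \<psi>). \<phi> \<in> \<Phi> \<and> \<psi> \<in> \<Phi> \<and> agree_on_edges k I \<phi> \<psi>})"
  define K where "K = (k + 1) ^ k"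
  have ESfin: "finite (ES \<phi>)" for \<phi> by (simp add: ES_def)
  have wpos: "0 < w S" for S unfolding w_def by (intro prod_pos) (simp add: pos)
  have finR: "finite R" by (rule finite_subset[of _ "\<Phi> \<times> \<Phi>"]) (auto simp: R_def fin)
  have finF: "finite (F S)" for S by (simp add: F_def fin)
  have finA: "finite (A S)" for S by (rule finite_subset[of _ "F S \<times> F S"]) (auto simp: A_def finF)
  have finB: "finite (B I)" for I by (rule finite_subset[of _ "\<Phi> \<times> \<Phi>"]) (auto simp: B_def fin)
  have wES: "w (ES \<phi>) = (\<Prod>i<k. p (cycle_edge k \<phi> i))" if "\<phi> \<in> \<Phi>" for \<phi>
    unfolding w_def ES_def by (subst prod.reindex[OF inj_on_cycle_edge[OF inj[OF that] k]]) simp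
  have block: "(\<Sum>x\<in>{x \<in> R. J x = S}. g x) \<le> K * (\<Sum>(\<phi>, \<psi>)\<in>A S. w (ES \<phi>) * w (ES \<psi>) / w S)"
    if S: "S \<in> J ` R" for S
  proof -
    obtain \<phi>\<^sub>0 where S0: "S \<subseteq> ES \<phi>\<^sub>0" using S by (auto simp: J_def)
    have US: "\<Union>S \<subseteq> \<phi>\<^sub>0 ` {..<k}"
    proof
      fix v assume "v \<in> \<Union>S"
      then obtain i where "i < k" "v \<in> cycle_edge k \<phi>\<^sub>0 i" using S0 by (auto simp: ES_def)
      then show "v \<in> \<phi>\<^sub>0 ` {..<k}" using k by (auto simp: cycle_edge_def)
    qed
    have finU: "finite (\<Union>S)" using US finite_subset by blast
    \<comment> \<open>All edges of \<open>S\<close> lie on one cycle, so \<open>S\<close> meets at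
      most \<open>k\<close> vertices. With \<open>None\<close> there are at most
      \<open>k + 1\<close> values at each position, whence the constant \<open>K\<close>.\<close>
    have cU: "card (\<Union>S) \<le> k"
      using card_mono[OF _ US] card_image_le[of "{..<k}" \<phi>\<^sub>0] by simp
    have "h S ` F S \<subseteq> {..<k} \<rightarrow>\<^sub>E insert None (Some ` \<Union>S)"
      unfolding h_def by (intro image_subsetI restrict_PiE_iff[THEN iffD2]) auto
    then have "card (h S ` F S) \<le> card ({..<k} \<rightarrow>\<^sub>E insert None (Some ` \<Union>S))"
      using finU by (intro card_mono finite_PiE) auto
    also have "\<dots> = (card (\<Union>S) + 1) ^ k"
      using finU by (simp add: card_PiE card_insert_if card_image)
    also have "\<dots> \<le> K" unfolding K_def using cU by (intro power_mono) auto
    finally have cK: "card (h S ` F S) \<le> K" .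
    have "(\<Sum>x\<in>{x \<in> R. J x = S}. g x) = (\<Sum>(\<phi>, \<psi>)\<in>{x \<in> R. J x = S}. w (ES \<phi>) * w (ES \<psi>) / w S)"
    proof (intro sum.cong refl, clarify)
      fix \<phi> \<psi> assume "S = J (\<phi>, \<psi>)"
      then have "S = ES \<phi> \<inter> ES \<psi>" by (simp add: J_def)
      then show "g (\<phi>, \<psi>) = w (ES \<phi>) * w (ES \<psi>) / w (J (\<phi>, \<psi>))"
        using prod.union_inter[OF ESfin ESfin, of p \<phi> \<psi>] wpos[of S]
        by (simp add: g_def w_def J_def field_simps)
    qed
    \<comment> \<open>Asking only that both cycles contain \<open>S\<close>, not that they meet
      exactly in \<open>S\<close>, makes the double sum a square.\<close>
    also have "\<dots> \<le> (\<Sum>(\<phi>, \<psi>)\<in>F S \<times> F S. w (ES \<phi>) * w (ES \<psi>) / w S)"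
      using finF wpos by (intro sum_mono2) (auto simp: R_def J_def F_def less_imp_le)
    also have "\<dots> = (\<Sum>\<phi>\<in>F S. w (ES \<phi>))\<^sup>2 / w S"
      by (simp add: power2_eq_square sum_product sum.cartesian_product sum_divide_distrib case_prod_unfold)
    also have "\<dots> \<le> K * (\<Sum>(\<phi>, \<psi>)\<in>A S. w (ES \<phi>) * w (ES \<psi>)) / w S"
      unfolding A_def using wpos cK
      by (intro divide_right_mono sum_square_le_card_image finF) (auto simp: less_imp_le)
    also have "\<dots> = K * (\<Sum>(\<phi>, \<psi>)\<in>A S. w (ES \<phi>) * w (ES \<psi>) / w S)"
      by (simp only: sum_divide_distrib[symmetric] case_prod_unfold times_divide_eq_right)
    finally show ?thesis .
  qed
  have agree: "agree_on_edges k {i. i < k \<and> cycle_edge k \<phi> i \<in> S} \<phi> \<psi>" if "(\<phi>, \<psi>) \<in> A S" for \<phi> \<psi> S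
    unfolding agree_on_edges_def
  proof
    fix i assume i: "i \<in> {i. i < k \<and> cycle_edge k \<phi> i \<in> S}"
    have eq: "\<phi> l = \<psi> l" if "l < k" "\<phi> l \<in> \<Union>S" for l
    proof -
      have "h S \<phi> l = h S \<psi> l" using \<open>(\<phi>, \<psi>) \<in> A S\<close> by (simp add: A_def)
      then show ?thesis using that unfolding h_def by (simp split: if_splits)
    qed
    have "\<phi> i \<in> \<Union>S" "\<phi> (Suc i mod k) \<in> \<Union>S" using i by (auto simp: cycle_edge_def)
    then show "\<phi> i = \<psi> i \<and> \<phi> (Suc i mod k) = \<psi> (Suc i mod k)"
      using i k by (intro conjI eq) auto
  qed
  have weight: "w (ES \<phi>) * w (ES \<psi>) / w (cycle_edge k \<phi> ` I) = T I \<phi> \<psi>"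
    if "\<phi> \<in> \<Phi>" "\<psi> \<in> \<Phi>" "I \<subseteq> {..<k}" "agree_on_edges k I \<phi> \<psi>" for I \<phi> \<psi>
  proof -
    let ?q = "\<lambda>\<phi> i. p (cycle_edge k \<phi> i)"
    have "w (cycle_edge k \<phi> ` I) = (\<Prod>i\<in>I. ?q \<phi> i)"
      unfolding w_def
      by (subst prod.reindex[OF inj_on_subset[OF inj_on_cycle_edge[OF inj[OF that(1)] k] that(3)]]) simp
    also have "\<dots> = (\<Prod>i<k. if i \<in> I then ?q \<phi> i else 1)"
      using that(3) by (simp add: prod.inter_restrict[symmetric] Int_absorb1)
    finally have wI: "w (cycle_edge k \<phi> ` I) = (\<Prod>i<k. if i \<in> I then ?q \<phi> i else 1)" .
    have "w (ES \<phi>) * w (ES \<psi>) = (\<Prod>i<k. ?q \<phi> i * ?q \<psi> i)"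
      by (simp add: wES that prod.distrib)
    also have "\<dots> = (\<Prod>i<k. (if i \<in> I then ?q \<phi> i else ?q \<phi> i * ?q \<psi> i) * (if i \<in> I then ?q \<phi> i else 1))"
      using that(4) by (intro prod.cong refl) (auto simp: agree_on_edges_def cycle_edge_def)
    also have "\<dots> = T I \<phi> \<psi> * w (cycle_edge k \<phi> ` I)"
      by (simp add: prod.distrib T_def wI)
    finally show ?thesis using wpos[of "cycle_edge k \<phi> ` I"] by (simp add: field_simps)
  qed
  have Tnn: "0 \<le> T I \<phi> \<psi>" for I \<phi> \<psi>
    unfolding T_def using pos by (intro prod_nonneg) (auto simp: less_imp_le)
  have "(\<Sum>x\<in>R. g x) = (\<Sum>S\<in>J ` R. \<Sum>x\<in>{x \<in> R. J x = S}. g x)"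
    by (rule sum.image_gen[OF finR])
  also have "\<dots> \<le> (\<Sum>S\<in>J ` R. K * (\<Sum>(\<phi>, \<psi>)\<in>A S. w (ES \<phi>) * w (ES \<psi>) / w S))"
    by (rule sum_mono) (rule block)
  also have "\<dots> = K * (\<Sum>(S, \<phi>, \<psi>)\<in>(SIGMA S:J ` R. A S). w (ES \<phi>) * w (ES \<psi>) / w S)"
    by (simp add: sum_distrib_left[symmetric] sum.Sigma finR finA case_prod_unfold)
  also have "(\<Sum>(S, \<phi>, \<psi>)\<in>(SIGMA S:J ` R. A S). w (ES \<phi>) * w (ES \<psi>) / w S)
      \<le> (\<Sum>(I, \<phi>, \<psi>)\<in>(SIGMA I:Pow {..<k} - {{}}. B I). T I \<phi> \<psi>)"
  \<comment> \<open>A term \<open>(S, \<phi>, \<psi>)\<close> is matched with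
    \<open>(I, \<phi>, \<psi>)\<close>, where \<open>I\<close> holds the positions at which \<phi>
    uses an edge of \<open>S\<close>. The map given here recovers \<open>S\<close> from
    \<open>I\<close> and \<phi>, so no term on the right is used twice.\<close>
  proof (rule sum_le_included[where i = "\<lambda>(I, \<phi>, \<psi>). (cycle_edge k \<phi> ` I, \<phi>, \<psi>)"])
    show "finite (SIGMA S:J ` R. A S)" using finR finA by (intro finite_SigmaI) auto
    show "finite (SIGMA I:Pow {..<k} - {{}}. B I)" using finB by (intro finite_SigmaI) auto
    show "\<forall>y\<in>(SIGMA I:Pow {..<k} - {{}}. B I). 0 \<le> (case y of (I, \<phi>, \<psi>) \<Rightarrow> T I \<phi> \<psi>)"
      using Tnn by auto
    show "\<forall>x\<in>(SIGMA S:J ` R. A S). \<exists>y\<in>(SIGMA I:Pow {..<k} - {{}}. B I).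
        (case y of (I, \<phi>, \<psi>) \<Rightarrow> (cycle_edge k \<phi> ` I, \<phi>, \<psi>)) = x \<and>
        (case x of (S, \<phi>, \<psi>) \<Rightarrow> w (ES \<phi>) * w (ES \<psi>) / w S) \<le> (case y of (I, \<phi>, \<psi>) \<Rightarrow> T I \<phi> \<psi>)"
    proof
      fix x assume x: "x \<in> (SIGMA S:J ` R. A S)"
      obtain S \<phi> \<psi> where xe: "x = (S, \<phi>, \<psi>)" by (cases x)
      have SJ: "S \<in> J ` R" and SA: "(\<phi>, \<psi>) \<in> A S" using x xe by auto
      define I where "I = {i. i < k \<and> cycle_edge k \<phi> i \<in> S}"
      have m: "\<phi> \<in> \<Phi>" "\<psi> \<in> \<Phi>" "S \<subseteq> ES \<phi>" using SA by (auto simp: A_def F_def)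
      have eI: "cycle_edge k \<phi> ` I = S" using m(3) by (auto simp: I_def ES_def)
      have "S \<noteq> {}" using SJ by (auto simp: J_def R_def)
      then have "I \<in> Pow {..<k} - {{}}" using eI by (auto simp: I_def)
      moreover have ag: "agree_on_edges k I \<phi> \<psi>" unfolding I_def by (rule agree[OF SA])
      moreover have "w (ES \<phi>) * w (ES \<psi>) / w S = T I \<phi> \<psi>"
        using weight[OF m(1,2) _ ag] eI by (auto simp: I_def)
      ultimately show "\<exists>y\<in>(SIGMA I:Pow {..<k} - {{}}. B I).
        (case y of (I, \<phi>, \<psi>) \<Rightarrow> (cycle_edge k \<phi> ` I, \<phi>, \<psi>)) = x \<and>
        (case x of (S, \<phi>, \<psi>) \<Rightarrow> w (ES \<phi>) * w (ES \<psi>) / w S) \<le> (case y of (I, \<phi>, \<psi>) \<Rightarrow> T I \<phi> \<psi>)"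
        using m eI by (intro bexI[of _ "(I, \<phi>, \<psi>)"]) (auto simp: xe B_def)
    qed
  qed
  also have "(\<Sum>(I, \<phi>, \<psi>)\<in>(SIGMA I:Pow {..<k} - {{}}. B I). T I \<phi> \<psi>) =
      (\<Sum>I\<in>Pow {..<k} - {{}}. \<Sum>(\<phi>, \<psi>)\<in>B I. T I \<phi> \<psi>)"
    by (simp add: sum.Sigma finB case_prod_unfold)
  finally show ?thesis
    unfolding R_def g_def B_def K_def by (simp add: mult_left_mono)
qed

section \<open>Moments of the number of cycles\<close>

lemma aas_of_variance:
  fixes X :: "nat \<Rightarrow> 'a \<Rightarrow> real"
  assumes fin: "\<And>n. finite (set_pmf (M n))" and pos: "\<And>n. 0 < a n"
    and mean: "(\<lambda>n. measure_pmf.expectation (M n) (X n) / a n) \<longlonglongrightarrow> 1"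
    and var: "(\<lambda>n. measure_pmf.variance (M n) (X n) / (a n)\<^sup>2) \<longlonglongrightarrow> 0"
  shows "\<exists>\<delta>. \<delta> \<longlonglongrightarrow> 0 \<and> aas M (\<lambda>n \<omega>. \<exists>\<eta>. \<bar>\<eta>\<bar> \<le> \<delta> n \<and> X n \<omega> = (1 + \<eta>) * a n)"
proof -
  define \<mu> where "\<mu> = (\<lambda>n. measure_pmf.expectation (M n) (X n))"
  \<comment> \<open>The added power of 1/2 keeps \<open>v\<close> positive even when the variance
    vanishes, as Chebyshev's inequality needs a positive threshold.\<close>
  define v where "v = (\<lambda>n. measure_pmf.variance (M n) (X n) / (a n)\<^sup>2 + (1/2) ^ n)"
  \<comment> \<open>With the fourth root as relative threshold, the failure probability is at most
    \<open>v n / (t n)\<^sup>2 = sqrt (v n)\<close>, so threshold and failure probability both tend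
    to 0.\<close>
  define t where "t = (\<lambda>n. sqrt (sqrt (v n)))"
  \<comment> \<open>The first summand pays for centring at \<open>a n\<close> in place of the
    mean.\<close>
  define \<delta> where "\<delta> = (\<lambda>n. \<bar>\<mu> n / a n - 1\<bar> + t n)"
  have vpos: "0 < v n" for n
    unfolding v_def by (intro add_nonneg_pos divide_nonneg_nonneg integral_nonneg) auto
  have v0: "v \<longlonglongrightarrow> 0"
    unfolding v_def using tendsto_add[OF var LIMSEQ_power_zero[of "1/2 :: real"]] by simp
  have sv0: "(\<lambda>n. sqrt (v n)) \<longlonglongrightarrow> 0" using tendsto_real_sqrt[OF v0] by simp
  have t0: "t \<longlonglongrightarrow> 0" unfolding t_def using tendsto_real_sqrt[OF sv0] by simp
  have tpos: "0 < t n" for n unfolding t_def using vpos by simp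
  have "\<delta> \<longlonglongrightarrow> 0"
    unfolding \<delta>_def \<mu>_def
    using tendsto_add[OF tendsto_rabs[OF tendsto_diff[OF mean tendsto_const[of 1]]] t0] by simp
  moreover have "aas M (\<lambda>n \<omega>. \<exists>\<eta>. \<bar>\<eta>\<bar> \<le> \<delta> n \<and> X n \<omega> = (1 + \<eta>) * a n)"
    unfolding aas_def
  proof (rule tendsto_sandwich)
    have "1 - sqrt (v n) \<le> measure_pmf.prob (M n) {\<omega>. \<exists>\<eta>. \<bar>\<eta>\<bar> \<le> \<delta> n \<and> X n \<omega> = (1 + \<eta>) * a n}" for n
    proof -
      have int: "integrable (measure_pmf (M n)) f" for f :: "'a \<Rightarrow> real"
        by (rule integrable_measure_pmf_finite[OF fin])
      let ?B = "{\<omega>. \<bar>X n \<omega> - \<mu> n\<bar> \<ge> t n * a n}"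
      have "measure_pmf.prob (M n) ?B \<le> measure_pmf.variance (M n) (X n) / (t n * a n)\<^sup>2"
        using measure_pmf.Chebyshev_inequality[of "X n" "M n" "t n * a n"] int tpos[of n] pos[of n]
        by (simp add: \<mu>_def)
      also have "\<dots> = measure_pmf.variance (M n) (X n) / (a n)\<^sup>2 / sqrt (v n)"
        using vpos[of n] by (simp add: power_mult_distrib t_def)
      also have "\<dots> \<le> v n / sqrt (v n)"
        using vpos[of n] by (intro divide_right_mono) (auto simp: v_def)
      also have "\<dots> = sqrt (v n)" using vpos[of n] by (simp add: real_div_sqrt)
      finally have B: "measure_pmf.prob (M n) ?B \<le> sqrt (v n)" .
      have "1 - measure_pmf.prob (M n) ?B = measure_pmf.prob (M n) (- ?B)"
        using measure_pmf.prob_compl[of ?B "M n"] by (simp add: Compl_eq_Diff_UNIV)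
      also have "\<dots> \<le> measure_pmf.prob (M n) {\<omega>. \<exists>\<eta>. \<bar>\<eta>\<bar> \<le> \<delta> n \<and> X n \<omega> = (1 + \<eta>) * a n}"
      proof (intro measure_pmf.finite_measure_mono subsetI)
        fix \<omega> assume "\<omega> \<in> - ?B"
        then have "\<bar>X n \<omega> - \<mu> n\<bar> \<le> t n * a n" by simp
        then have "\<bar>X n \<omega> - \<mu> n\<bar> / a n \<le> t n" using pos[of n] by (simp add: divide_le_eq)
        moreover have "X n \<omega> / a n - 1 = (X n \<omega> - \<mu> n) / a n + (\<mu> n / a n - 1)"
          by (simp add: diff_divide_distrib)
        moreover have "\<bar>(X n \<omega> - \<mu> n) / a n\<bar> = \<bar>X n \<omega> - \<mu> n\<bar> / a n"
          using pos[of n] by simp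
        ultimately have "\<bar>X n \<omega> / a n - 1\<bar> \<le> \<delta> n" unfolding \<delta>_def by linarith
        moreover have "X n \<omega> = (1 + (X n \<omega> / a n - 1)) * a n" using pos[of n] by simp
        ultimately show "\<omega> \<in> {\<omega>. \<exists>\<eta>. \<bar>\<eta>\<bar> \<le> \<delta> n \<and> X n \<omega> = (1 + \<eta>) * a n}" by blast
      qed simp
      finally show ?thesis using B by linarith
    qed
    then show "\<forall>\<^sub>F n in sequentially. 1 - sqrt (v n) \<le> measure_pmf.prob (M n) {\<omega>. \<exists>\<eta>. \<bar>\<eta>\<bar> \<le> \<delta> n \<and> X n \<omega> = (1 + \<eta>) * a n}"
      by (rule always_eventually[OF allI])
    show "(\<lambda>n. 1 - sqrt (v n)) \<longlonglongrightarrow> 1" using tendsto_diff[OF tendsto_const[of 1] sv0] by simp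
  qed auto
  ultimately show ?thesis by blast
qed

section \<open>The number of cycles as a sum of indicators of edge sets\<close>

definition cycle_embeddings :: "nat \<Rightarrow> nat \<Rightarrow> (nat \<Rightarrow> bool list) set" where
  "cycle_embeddings k n = {\<phi> \<in> {..<k} \<rightarrow>\<^sub>E kron_vertices n. inj_on \<phi> {..<k}}"

lemma finite_cycle_embeddings: "finite (cycle_embeddings k n)"
  using finite_cycle_maps[of k n] by (auto simp: cycle_embeddings_def)

lemma cycle_copies_eq:
  "cycle_copies k n E = {\<phi> \<in> cycle_embeddings k n. cycle_edge k \<phi> ` {..<k} \<subseteq> E}"
proof -
  have "cycle_edges k = (\<lambda>i. {i, Suc i mod k}) ` {..<k}" by (auto simp: cycle_edges_def)
  then show ?thesis
    by (auto simp: cycle_copies_def labeled_copies_def cycle_embeddings_def cycle_vertices_def cycle_edge_def)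
qed

lemma cycle_edge_in_vertex_pairs:
  assumes "\<phi> \<in> cycle_embeddings k n" "3 \<le> k"
  shows "cycle_edge k \<phi> ` {..<k} \<subseteq> vertex_pairs (kron_vertices n)"
proof (rule image_subsetI)
  fix i assume i: "i \<in> {..<k}"
  have s: "Suc i mod k \<in> {..<k}" "Suc i mod k \<noteq> i" using i assms(2) Suc_mod_neq[of i k] by auto
  have "\<phi> i \<in> kron_vertices n" "\<phi> (Suc i mod k) \<in> kron_vertices n"
    using assms i s by (auto simp: cycle_embeddings_def PiE_iff)
  moreover have "\<phi> i \<noteq> \<phi> (Suc i mod k)"
    using assms i s by (auto simp: cycle_embeddings_def inj_on_def)
  ultimately show "cycle_edge k \<phi> i \<in> vertex_pairs (kron_vertices n)"
    unfolding cycle_edge_def vertex_pairs_def by blast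
qed

lemma finite_vertex_pairs: "finite V \<Longrightarrow> finite (vertex_pairs V)"
  by (rule finite_subset[of _ "Pow V"]) (auto simp: vertex_pairs_def)

lemma finite_set_kronecker_graph: "finite (set_pmf (kronecker_graph n P))"
proof (rule finite_subset)
  show "set_pmf (kronecker_graph n P) \<subseteq> Pow (vertex_pairs (kron_vertices n))"
    by (auto simp: kronecker_graph_def)
  show "finite (Pow (vertex_pairs (kron_vertices n)))"
    by (simp add: finite_vertex_pairs finite_kron_vertices)
qed

lemma kron_prob_bounds:
  assumes "\<And>a b. 0 < P a b" "\<And>a b. P a b \<le> 1"
  shows "0 < kron_prob n P u v" "kron_prob n P u v \<le> 1"
  unfolding kron_prob_def using assms
  by (auto intro!: prod_pos prod_le_1 simp: less_imp_le)

lemma prob_edges_subset: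
  assumes sym: "\<And>a b. P a b = P b a" and P: "\<And>a b. 0 < P a b" "\<And>a b. P a b \<le> 1"
    and S: "S \<subseteq> vertex_pairs (kron_vertices n)"
  shows "measure_pmf.prob (kronecker_graph n P) {E. S \<subseteq> E} = (\<Prod>e\<in>S. kron_pair_prob n P e)"
proof -
  let ?U = "vertex_pairs (kron_vertices n)"
  have fin: "finite ?U" by (simp add: finite_vertex_pairs finite_kron_vertices)
  have bounds: "0 \<le> kron_pair_prob n P e \<and> kron_pair_prob n P e \<le> 1" if "e \<in> ?U" for e
    using that kron_prob_bounds[of P, OF P]
    by (auto simp: vertex_pairs_def kron_pair_prob_insert[OF sym] less_imp_le)
  \<comment> \<open>The event is a box: coordinates in \<open>S\<close> must be true and the others
    are free. Independence then turns its probability into a product.\<close>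
  have "(\<lambda>\<omega>. {e \<in> ?U. \<omega> e}) -` {E. S \<subseteq> E} = Pi ?U (\<lambda>e. if e \<in> S then {True} else UNIV)"
    using S by (auto simp: Pi_def split: if_splits)
  then have "measure_pmf.prob (kronecker_graph n P) {E. S \<subseteq> E} =
      (\<Prod>e\<in>?U. measure_pmf.prob (bernoulli_pmf (kron_pair_prob n P e)) (if e \<in> S then {True} else UNIV))"
    by (simp add: kronecker_graph_def measure_Pi_pmf_Pi[OF fin])
  also have "\<dots> = (\<Prod>e\<in>?U. if e \<in> S then kron_pair_prob n P e else 1)"
    using bounds by (intro prod.cong refl) (auto simp: measure_pmf_single)
  also have "\<dots> = (\<Prod>e\<in>S. kron_pair_prob n P e)"
    using S fin by (simp add: prod.inter_restrict[symmetric] Int_absorb1)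
  finally show ?thesis .
qed

lemma card_cycle_copies:
  "real (card (cycle_copies k n E)) = (\<Sum>\<phi>\<in>cycle_embeddings k n. of_bool (cycle_edge k \<phi> ` {..<k} \<subseteq> E))"
  using finite_cycle_embeddings[of k n] by (simp add: cycle_copies_eq Int_def)

lemma expectation_of_bool:
  "measure_pmf.expectation M (\<lambda>\<omega>. of_bool (Q \<omega>)) = measure_pmf.prob M {\<omega>. Q \<omega>}"
proof -
  have "(\<lambda>\<omega>. of_bool (Q \<omega>) :: real) = indicator {\<omega>. Q \<omega>}" by (auto simp: indicator_def)
  then show ?thesis by simp
qed

context
  fixes n k :: nat and P :: "bool \<Rightarrow> bool \<Rightarrow> real"
  assumes sym: "\<And>a b. P a b = P b a" and P: "\<And>a b. 0 < P a b" "\<And>a b. P a b \<le> 1" and k: "3 \<le> k"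
begin

lemma cycle_weight_eq_prod_edges:
  assumes "\<phi> \<in> cycle_embeddings k n"
  shows "(\<Prod>e\<in>cycle_edge k \<phi> ` {..<k}. kron_pair_prob n P e) = cycle_weight n P k \<phi>"
proof -
  have "inj_on (cycle_edge k \<phi>) {..<k}"
    using assms k by (intro inj_on_cycle_edge) (auto simp: cycle_embeddings_def)
  then show ?thesis
    by (subst prod.reindex) (simp_all add: cycle_weight_def cycle_edge_def kron_pair_prob_insert[OF sym])
qed

lemma expectation_cycle_copies:
  "measure_pmf.expectation (kronecker_graph n P) (\<lambda>E. real (card (cycle_copies k n E))) =
    (\<Sum>\<phi>\<in>cycle_embeddings k n. cycle_weight n P k \<phi>)"
proof -
  have int: "integrable (measure_pmf (kronecker_graph n P)) f" for f :: "_ \<Rightarrow> real"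
    by (rule integrable_measure_pmf_finite[OF finite_set_kronecker_graph])
  have "measure_pmf.expectation (kronecker_graph n P) (\<lambda>E. real (card (cycle_copies k n E))) =
      (\<Sum>\<phi>\<in>cycle_embeddings k n. measure_pmf.prob (kronecker_graph n P) {E. cycle_edge k \<phi> ` {..<k} \<subseteq> E})"
    unfolding card_cycle_copies by (subst Bochner_Integration.integral_sum[OF int]) (simp only: expectation_of_bool)
  also have "\<dots> = (\<Sum>\<phi>\<in>cycle_embeddings k n. cycle_weight n P k \<phi>)"
    by (intro sum.cong refl)
      (simp add: prob_edges_subset[OF sym P cycle_edge_in_vertex_pairs[OF _ k]] cycle_weight_eq_prod_edges)
  finally show ?thesis .
qed

lemma expectation_cycle_copies_square:
  "measure_pmf.expectation (kronecker_graph n P) (\<lambda>E. (real (card (cycle_copies k n E)))\<^sup>2) =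
    (\<Sum>(\<phi>, \<psi>)\<in>cycle_embeddings k n \<times> cycle_embeddings k n.
      \<Prod>e\<in>cycle_edge k \<phi> ` {..<k} \<union> cycle_edge k \<psi> ` {..<k}. kron_pair_prob n P e)"
proof -
  let ?\<Phi> = "cycle_embeddings k n"
  let ?S = "\<lambda>\<phi>. cycle_edge k \<phi> ` {..<k}"
  have int: "integrable (measure_pmf (kronecker_graph n P)) f" for f :: "_ \<Rightarrow> real"
    by (rule integrable_measure_pmf_finite[OF finite_set_kronecker_graph])
  have sq: "(real (card (cycle_copies k n E)))\<^sup>2 = (\<Sum>x\<in>?\<Phi> \<times> ?\<Phi>. of_bool (?S (fst x) \<union> ?S (snd x) \<subseteq> E))" for E
    unfolding card_cycle_copies power2_eq_square sum_product sum.cartesian_product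
    by (intro sum.cong refl) (simp add: case_prod_unfold of_bool_conj[symmetric] del: image_subset_iff)
  have "measure_pmf.expectation (kronecker_graph n P) (\<lambda>E. (real (card (cycle_copies k n E)))\<^sup>2) =
      (\<Sum>x\<in>?\<Phi> \<times> ?\<Phi>. measure_pmf.prob (kronecker_graph n P) {E. ?S (fst x) \<union> ?S (snd x) \<subseteq> E})"
    unfolding sq by (subst Bochner_Integration.integral_sum[OF int]) (simp only: expectation_of_bool)
  also have "\<dots> = (\<Sum>x\<in>?\<Phi> \<times> ?\<Phi>. \<Prod>e\<in>?S (fst x) \<union> ?S (snd x). kron_pair_prob n P e)"
  proof (intro sum.cong refl prob_edges_subset[OF sym P])
    fix x assume "x \<in> ?\<Phi> \<times> ?\<Phi>"
    then show "?S (fst x) \<union> ?S (snd x) \<subseteq> vertex_pairs (kron_vertices n)"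
      by (intro Un_least cycle_edge_in_vertex_pairs[OF _ k]) auto
  qed
  finally show ?thesis by (simp only: case_prod_unfold)
qed

lemma variance_cycle_copies_le:
  "measure_pmf.variance (kronecker_graph n P) (\<lambda>E. real (card (cycle_copies k n E))) \<le>
    real ((k + 1) ^ k) * (\<Sum>I\<in>Pow {..<k} - {{}}.
      \<Sum>(\<phi>, \<psi>)\<in>{(\<phi>, \<psi>). \<phi> \<in> {..<k} \<rightarrow>\<^sub>E kron_vertices n \<and> \<psi> \<in> {..<k} \<rightarrow>\<^sub>E kron_vertices n \<and> agree_on_edges k I \<phi> \<psi>}.
        \<Prod>i<k. if i \<in> I then kron_prob n P (\<phi> i) (\<phi> (Suc i mod k))
          else kron_prob n P (\<phi> i) (\<phi> (Suc i mod k)) * kron_prob n P (\<psi> i) (\<psi> (Suc i mod k)))"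
  (is "_ \<le> _ * (\<Sum>I\<in>_. \<Sum>x\<in>?B I. ?t I x)")
proof -
  let ?\<Phi> = "cycle_embeddings k n"
  let ?M = "kronecker_graph n P"
  let ?X = "\<lambda>E. real (card (cycle_copies k n E))"
  let ?S = "\<lambda>\<phi>. cycle_edge k \<phi> ` {..<k}"
  let ?g = "\<lambda>(\<phi>, \<psi>). \<Prod>e\<in>?S \<phi> \<union> ?S \<psi>. kron_pair_prob n P e"
  let ?R = "{(\<phi>, \<psi>). \<phi> \<in> ?\<Phi> \<and> \<psi> \<in> ?\<Phi> \<and> ?S \<phi> \<inter> ?S \<psi> \<noteq> {}}"
  \<comment> \<open>\<open>kron_pair_prob\<close> is a junk value on sets that are not unordered pairs.\<close>
  define p where "p = (\<lambda>e. if \<exists>u v. e = {u, v} then kron_pair_prob n P e else 1)"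
  have pe: "p (cycle_edge k \<phi> i) = kron_prob n P (\<phi> i) (\<phi> (Suc i mod k))" for \<phi> i
    by (auto simp: p_def cycle_edge_def kron_pair_prob_insert[OF sym])
  have ppos: "0 < p e" for e
    using kron_prob_bounds[of P n, OF P] by (auto simp: p_def kron_pair_prob_insert[OF sym])
  have int: "integrable (measure_pmf ?M) f" for f :: "_ \<Rightarrow> real"
    by (rule integrable_measure_pmf_finite[OF finite_set_kronecker_graph])
  have wnn: "0 \<le> cycle_weight n P k \<phi>" for \<phi>
    unfolding cycle_weight_def using kron_prob_bounds[of P n, OF P] by (intro prod_nonneg) (simp add: less_imp_le)
  have split: "(\<Sum>x\<in>?\<Phi> \<times> ?\<Phi>. ?g x) = (\<Sum>x\<in>?\<Phi> \<times> ?\<Phi> - ?R. ?g x) + (\<Sum>x\<in>?R. ?g x)"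
    by (rule sum.subset_diff) (auto simp: finite_cycle_embeddings)
  \<comment> \<open>Edge-disjoint pairs are independent, so their weights multiply. Their total is
    at most the squared mean, which the variance subtracts.\<close>
  have "(\<Sum>x\<in>?\<Phi> \<times> ?\<Phi> - ?R. ?g x) = (\<Sum>(\<phi>, \<psi>)\<in>?\<Phi> \<times> ?\<Phi> - ?R. cycle_weight n P k \<phi> * cycle_weight n P k \<psi>)"
  proof (intro sum.cong refl)
    fix x assume "x \<in> ?\<Phi> \<times> ?\<Phi> - ?R"
    then obtain \<phi> \<psi> where x: "x = (\<phi>, \<psi>)" and H: "\<phi> \<in> ?\<Phi>" "\<psi> \<in> ?\<Phi>" "?S \<phi> \<inter> ?S \<psi> = {}"
      by blast
    show "?g x = (case x of (\<phi>, \<psi>) \<Rightarrow> cycle_weight n P k \<phi> * cycle_weight n P k \<psi>)"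
      unfolding x prod.case using H
      by (subst prod.union_disjoint) (simp_all add: cycle_weight_eq_prod_edges)
  qed
  also have "\<dots> \<le> (\<Sum>(\<phi>, \<psi>)\<in>?\<Phi> \<times> ?\<Phi>. cycle_weight n P k \<phi> * cycle_weight n P k \<psi>)"
  proof (rule sum_mono2)
    show "finite (?\<Phi> \<times> ?\<Phi>)" by (simp add: finite_cycle_embeddings)
    show "?\<Phi> \<times> ?\<Phi> - ?R \<subseteq> ?\<Phi> \<times> ?\<Phi>" by (rule Diff_subset)
    show "0 \<le> (case x of (\<phi>, \<psi>) \<Rightarrow> cycle_weight n P k \<phi> * cycle_weight n P k \<psi>)" for x
      using wnn by (cases x) simp
  qed
  also have "\<dots> = (measure_pmf.expectation ?M ?X)\<^sup>2"
    by (simp add: expectation_cycle_copies power2_eq_square sum_product sum.cartesian_product)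
  finally have disjoint: "(\<Sum>x\<in>?\<Phi> \<times> ?\<Phi> - ?R. ?g x) \<le> (measure_pmf.expectation ?M ?X)\<^sup>2" .
  have "measure_pmf.variance ?M ?X = (\<Sum>x\<in>?\<Phi> \<times> ?\<Phi>. ?g x) - (measure_pmf.expectation ?M ?X)\<^sup>2"
    by (simp only: measure_pmf.variance_eq[OF int int] expectation_cycle_copies_square)
  then have "measure_pmf.variance ?M ?X \<le> (\<Sum>x\<in>?R. ?g x)"
    using split disjoint by linarith
  also have "(\<Sum>x\<in>?R. ?g x) = (\<Sum>(\<phi>, \<psi>)\<in>?R. \<Prod>e\<in>?S \<phi> \<union> ?S \<psi>. p e)"
  proof -
    have "(\<Prod>e\<in>?S \<phi> \<union> ?S \<psi>. kron_pair_prob n P e) = (\<Prod>e\<in>?S \<phi> \<union> ?S \<psi>. p e)" for \<phi> \<psi>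
    proof (intro prod.cong refl)
      fix e assume "e \<in> ?S \<phi> \<union> ?S \<psi>"
      then have "\<exists>u v. e = {u, v}" unfolding cycle_edge_def by blast
      then show "kron_pair_prob n P e = p e" by (simp only: p_def if_True)
    qed
    then show ?thesis by simp
  qed
  also have "\<dots> \<le> real ((k + 1) ^ k) * (\<Sum>I\<in>Pow {..<k} - {{}}.
      \<Sum>x\<in>{(\<phi>, \<psi>). \<phi> \<in> ?\<Phi> \<and> \<psi> \<in> ?\<Phi> \<and> agree_on_edges k I \<phi> \<psi>}. ?t I x)"
  proof -
    have "inj_on \<phi> {..<k}" if "\<phi> \<in> ?\<Phi>" for \<phi> using that by (simp add: cycle_embeddings_def)
    from sum_overlapping_pairs_le[where p = p and \<Phi> = ?\<Phi>, OF k ppos finite_cycle_embeddings this] show ?thesis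
      unfolding pe .
  qed
  \<comment> \<open>Injectivity is dropped because only the sum over all maps factors over the
    digits.\<close>
  also have "\<dots> \<le> real ((k + 1) ^ k) * (\<Sum>I\<in>Pow {..<k} - {{}}. \<Sum>x\<in>?B I. ?t I x)"
  proof (intro mult_left_mono sum_mono sum_mono2)
    fix I
    show "finite (?B I)"
      by (rule finite_subset[of _ "({..<k} \<rightarrow>\<^sub>E kron_vertices n) \<times> ({..<k} \<rightarrow>\<^sub>E kron_vertices n)"])
        (auto simp: finite_cycle_maps)
    show "{(\<phi>, \<psi>). \<phi> \<in> ?\<Phi> \<and> \<psi> \<in> ?\<Phi> \<and> agree_on_edges k I \<phi> \<psi>} \<subseteq> ?B I"
      by (auto simp: cycle_embeddings_def)
    show "0 \<le> ?t I x" for x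
      using kron_prob_bounds[of P n, OF P] by (cases x) (auto intro!: prod_nonneg simp: less_imp_le)
  qed simp
  finally show ?thesis .
qed

end

section \<open>Asymptotics\<close>

lemma power_sum_diff_nonneg:
  fixes \<alpha> \<beta> :: real
  assumes "0 \<le> \<alpha>" "0 \<le> \<beta>"
  shows "0 \<le> (\<alpha> + \<beta>) ^ k + (\<alpha> - \<beta>) ^ k"
proof -
  have "\<bar>(\<alpha> - \<beta>) ^ k\<bar> \<le> (\<alpha> + \<beta>) ^ k"
    unfolding power_abs using assms by (intro power_mono) auto
  then show ?thesis by linarith
qed

lemma initiator_bounds:
  assumes "0 < \<alpha>" "\<alpha> < 1" "0 < \<beta>" "\<beta> < 1"
  shows "0 < initiator \<alpha> \<beta> \<alpha> a b" "initiator \<alpha> \<beta> \<alpha> a b \<le> 1"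
  using assms by (auto simp: initiator_def)

lemma cycle_weight_nonneg:
  assumes "0 \<le> \<alpha>" "0 \<le> \<beta>"
  shows "0 \<le> cycle_weight n (initiator \<alpha> \<beta> \<alpha>) k \<phi>"
  unfolding cycle_weight_def kron_prob_def using assms
  by (intro prod_nonneg ballI) (auto simp: initiator_def)

lemma expectation_cycle_copies_le:
  assumes "0 < \<alpha>" "\<alpha> < 1" "0 < \<beta>" "\<beta> < 1" "3 \<le> k"
  shows "measure_pmf.expectation (kronecker_graph n (initiator \<alpha> \<beta> \<alpha>)) (\<lambda>E. real (card (cycle_copies k n E)))
    \<le> ((\<alpha> + \<beta>) ^ k + (\<alpha> - \<beta>) ^ k) ^ n"
proof -
  have "(\<Sum>\<phi>\<in>cycle_embeddings k n. cycle_weight n (initiator \<alpha> \<beta> \<alpha>) k \<phi>)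
      \<le> (\<Sum>\<phi>\<in>{..<k} \<rightarrow>\<^sub>E kron_vertices n. cycle_weight n (initiator \<alpha> \<beta> \<alpha>) k \<phi>)"
    using assms by (intro sum_mono2 finite_cycle_maps cycle_weight_nonneg) (auto simp: cycle_embeddings_def)
  then show ?thesis
    using assms
    by (simp add: expectation_cycle_copies[OF initiator_commute initiator_bounds] sum_cycle_weight)
qed

lemma sum_UNION_le:
  fixes f :: "'b \<Rightarrow> real"
  assumes "finite I" "\<And>i. i \<in> I \<Longrightarrow> finite (A i)" "\<And>x. 0 \<le> f x"
  shows "(\<Sum>x\<in>(\<Union>i\<in>I. A i). f x) \<le> (\<Sum>i\<in>I. \<Sum>x\<in>A i. f x)"
proof -
  have "(\<Sum>x\<in>(\<Union>i\<in>I. A i). f x) \<le> (\<Sum>y\<in>(SIGMA i:I. A i). f (snd y))"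
    using assms by (intro sum_le_included[where i = snd]) (auto intro: finite_SigmaI)
  also have "\<dots> = (\<Sum>i\<in>I. \<Sum>x\<in>A i. f x)"
    using assms by (simp add: sum.Sigma case_prod_unfold)
  finally show ?thesis .
qed

text \<open>The mean is squeezed between the full walk sum and that sum minus the collision terms.
  There are finitely many pairs of positions, and each collision term is geometrically
  smaller.\<close>

lemma expectation_cycle_copies_asymp:
  assumes "0 < \<alpha>" "\<alpha> < 1" "0 < \<beta>" "\<beta> < 1" "3 \<le> k"
    and lam: "0 < (\<alpha> + \<beta>) ^ k + (\<alpha> - \<beta>) ^ k"
  shows "(\<lambda>n. measure_pmf.expectation (kronecker_graph n (initiator \<alpha> \<beta> \<alpha>)) (\<lambda>E. real (card (cycle_copies k n E)))
    / ((\<alpha> + \<beta>) ^ k + (\<alpha> - \<beta>) ^ k) ^ n) \<longlonglongrightarrow> 1"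
proof -
  let ?P = "initiator \<alpha> \<beta> \<alpha>"
  define \<Lambda> where "\<Lambda> = (\<alpha> + \<beta>) ^ k + (\<alpha> - \<beta>) ^ k"
  define N where "N = {(i, j). i < k \<and> j < k \<and> i \<noteq> j}"
  let ?C = "\<lambda>n i j. {\<phi> \<in> {..<k} \<rightarrow>\<^sub>E kron_vertices n. \<phi> i = \<phi> j}"
  have "\<forall>x\<in>N. \<exists>\<theta>. 0 \<le> \<theta> \<and> \<theta> < \<Lambda> \<and>
      (\<forall>n. (\<Sum>\<phi>\<in>?C n (fst x) (snd x). cycle_weight n ?P k \<phi>) \<le> \<theta> ^ n)"
  proof
    fix x assume "x \<in> N"
    then have "fst x < k" "snd x < k" "fst x \<noteq> snd x" by (auto simp: N_def)
    from sum_cycle_weight_collision[OF this assms(1,3)]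
    show "\<exists>\<theta>. 0 \<le> \<theta> \<and> \<theta> < \<Lambda> \<and>
      (\<forall>n. (\<Sum>\<phi>\<in>?C n (fst x) (snd x). cycle_weight n ?P k \<phi>) \<le> \<theta> ^ n)"
      unfolding \<Lambda>_def .
  qed
  from bchoice[OF this] obtain \<theta> where
    \<theta>: "\<And>x. x \<in> N \<Longrightarrow> 0 \<le> \<theta> x" "\<And>x. x \<in> N \<Longrightarrow> \<theta> x < \<Lambda>"
      "\<And>x n. x \<in> N \<Longrightarrow> (\<Sum>\<phi>\<in>?C n (fst x) (snd x). cycle_weight n ?P k \<phi>) \<le> \<theta> x ^ n"
    by blast
  have finN: "finite N" by (rule finite_subset[of _ "{..<k} \<times> {..<k}"]) (auto simp: N_def)
  have lower: "\<Lambda> ^ n - (\<Sum>x\<in>N. \<theta> x ^ n) \<le> (\<Sum>\<phi>\<in>cycle_embeddings k n. cycle_weight n ?P k \<phi>)" for n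
  proof -
    let ?A = "{..<k} \<rightarrow>\<^sub>E kron_vertices n"
    have wnn: "0 \<le> cycle_weight n ?P k \<phi>" for \<phi> using assms by (intro cycle_weight_nonneg) auto
    \<comment> \<open>A map that is not injective identifies some pair of positions in
      \<open>N\<close>.\<close>
    have "?A \<subseteq> cycle_embeddings k n \<union> (\<Union>x\<in>N. ?C n (fst x) (snd x))"
      by (force simp: cycle_embeddings_def N_def inj_on_def)
    then have "(\<Sum>\<phi>\<in>?A. cycle_weight n ?P k \<phi>)
        \<le> (\<Sum>\<phi>\<in>cycle_embeddings k n \<union> (\<Union>x\<in>N. ?C n (fst x) (snd x)). cycle_weight n ?P k \<phi>)"
      using finN finite_cycle_maps finite_cycle_embeddings wnn by (intro sum_mono2) auto
    also have "\<dots> \<le> (\<Sum>\<phi>\<in>cycle_embeddings k n. cycle_weight n ?P k \<phi>)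
        + (\<Sum>\<phi>\<in>(\<Union>x\<in>N. ?C n (fst x) (snd x)). cycle_weight n ?P k \<phi>)"
      using finN finite_cycle_maps finite_cycle_embeddings wnn
      by (subst sum_Un) (auto intro!: sum_nonneg)
    also have "(\<Sum>\<phi>\<in>(\<Union>x\<in>N. ?C n (fst x) (snd x)). cycle_weight n ?P k \<phi>)
        \<le> (\<Sum>x\<in>N. \<Sum>\<phi>\<in>?C n (fst x) (snd x). cycle_weight n ?P k \<phi>)"
      using finN finite_cycle_maps wnn by (intro sum_UNION_le) auto
    also have "\<dots> \<le> (\<Sum>x\<in>N. \<theta> x ^ n)" by (intro sum_mono \<theta>)
    finally show ?thesis
      using sum_cycle_weight[of k n \<alpha> \<beta>] assms by (simp add: \<Lambda>_def)
  qed
  have L0: "0 < \<Lambda>" using lam by (simp add: \<Lambda>_def)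
  show ?thesis
    unfolding \<Lambda>_def[symmetric]
  proof (rule tendsto_sandwich)
    show "\<forall>\<^sub>F n in sequentially. 1 - (\<Sum>x\<in>N. (\<theta> x / \<Lambda>) ^ n) \<le>
        measure_pmf.expectation (kronecker_graph n ?P) (\<lambda>E. real (card (cycle_copies k n E))) / \<Lambda> ^ n"
    proof (intro always_eventually allI)
      fix n
      have "1 - (\<Sum>x\<in>N. (\<theta> x / \<Lambda>) ^ n) = (\<Lambda> ^ n - (\<Sum>x\<in>N. \<theta> x ^ n)) / \<Lambda> ^ n"
        using L0 by (simp add: diff_divide_distrib sum_divide_distrib power_divide)
      also have "\<dots> \<le> (\<Sum>\<phi>\<in>cycle_embeddings k n. cycle_weight n ?P k \<phi>) / \<Lambda> ^ n"
        using L0 lower[of n] by (intro divide_right_mono) auto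
      finally show "1 - (\<Sum>x\<in>N. (\<theta> x / \<Lambda>) ^ n) \<le>
        measure_pmf.expectation (kronecker_graph n ?P) (\<lambda>E. real (card (cycle_copies k n E))) / \<Lambda> ^ n"
        using assms by (simp add: expectation_cycle_copies[OF initiator_commute initiator_bounds])
    qed
    show "\<forall>\<^sub>F n in sequentially.
        measure_pmf.expectation (kronecker_graph n ?P) (\<lambda>E. real (card (cycle_copies k n E))) / \<Lambda> ^ n \<le> 1"
      using expectation_cycle_copies_le[OF assms(1-5)] L0 by (simp add: \<Lambda>_def)
    have "(\<lambda>n. 1 - (\<Sum>x\<in>N. (\<theta> x / \<Lambda>) ^ n)) \<longlonglongrightarrow> 1 - (\<Sum>x\<in>N. 0)"
      using \<theta>(1,2) L0 by (intro tendsto_intros LIMSEQ_power_zero) auto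
    then show "(\<lambda>n. 1 - (\<Sum>x\<in>N. (\<theta> x / \<Lambda>) ^ n)) \<longlonglongrightarrow> 1" by simp
  qed simp
qed

text \<open>For fixed \<open>k\<close> there are finitely many sets \<open>I\<close>, and each
  contributes a geometric sequence of ratio below 1 after division by the squared
  normaliser.\<close>

lemma variance_cycle_copies_asymp:
  assumes "0 < \<alpha>" "\<alpha> < 1" "0 < \<beta>" "\<beta> < 1" "3 \<le> k"
    and lam: "1 < (\<alpha> + \<beta>) ^ k + (\<alpha> - \<beta>) ^ k"
  shows "(\<lambda>n. measure_pmf.variance (kronecker_graph n (initiator \<alpha> \<beta> \<alpha>)) (\<lambda>E. real (card (cycle_copies k n E)))
    / (((\<alpha> + \<beta>) ^ k + (\<alpha> - \<beta>) ^ k) ^ n)\<^sup>2) \<longlonglongrightarrow> 0"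
proof -
  let ?P = "initiator \<alpha> \<beta> \<alpha>"
  let ?V = "\<lambda>n. measure_pmf.variance (kronecker_graph n ?P) (\<lambda>E. real (card (cycle_copies k n E)))"
  let ?D = "\<lambda>I. pair_cycle_sum \<alpha> \<beta> k I"
  define \<Lambda> where "\<Lambda> = (\<alpha> + \<beta>) ^ k + (\<alpha> - \<beta>) ^ k"
  have L0: "0 < \<Lambda>" using lam by (simp add: \<Lambda>_def)
  have D0: "0 \<le> ?D I" for I
    unfolding pair_cycle_sum_def using assms
    by (intro sum_nonneg prod_nonneg) (auto simp: pair_step_def initiator_def)
  have bound: "?V n \<le> real ((k + 1) ^ k) * (\<Sum>I\<in>Pow {..<k} - {{}}. ?D I ^ n)" for n
  proof -
    note variance_cycle_copies_le[of ?P k n, OF initiator_commute initiator_bounds[OF assms(1-4)] assms(5)]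
    also have "real ((k + 1) ^ k) * (\<Sum>I\<in>Pow {..<k} - {{}}.
      \<Sum>(\<phi>, \<psi>)\<in>{(\<phi>, \<psi>). \<phi> \<in> {..<k} \<rightarrow>\<^sub>E kron_vertices n \<and> \<psi> \<in> {..<k} \<rightarrow>\<^sub>E kron_vertices n \<and> agree_on_edges k I \<phi> \<psi>}.
        \<Prod>i<k. if i \<in> I then kron_prob n ?P (\<phi> i) (\<phi> (Suc i mod k))
          else kron_prob n ?P (\<phi> i) (\<phi> (Suc i mod k)) * kron_prob n ?P (\<psi> i) (\<psi> (Suc i mod k)))
      \<le> real ((k + 1) ^ k) * (\<Sum>I\<in>Pow {..<k} - {{}}. ?D I ^ n)"
      using assms by (intro mult_left_mono sum_mono sum_agreeing_pairs_le) auto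
    finally show ?thesis .
  qed
  show ?thesis
    unfolding \<Lambda>_def[symmetric]
  proof (rule tendsto_sandwich)
    show "\<forall>\<^sub>F n in sequentially. 0 \<le> ?V n / (\<Lambda> ^ n)\<^sup>2" by simp
    show "\<forall>\<^sub>F n in sequentially. ?V n / (\<Lambda> ^ n)\<^sup>2 \<le>
        real ((k + 1) ^ k) * (\<Sum>I\<in>Pow {..<k} - {{}}. (?D I / \<Lambda>\<^sup>2) ^ n)"
    proof (intro always_eventually allI)
      fix n
      have "?V n / (\<Lambda> ^ n)\<^sup>2 \<le> real ((k + 1) ^ k) * (\<Sum>I\<in>Pow {..<k} - {{}}. ?D I ^ n) / (\<Lambda> ^ n)\<^sup>2"
        using bound[of n] by (intro divide_right_mono) auto
      also have "\<dots> = real ((k + 1) ^ k) * (\<Sum>I\<in>Pow {..<k} - {{}}. (?D I / \<Lambda>\<^sup>2) ^ n)"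
        by (simp only: times_divide_eq_right[symmetric] sum_divide_distrib power_divide power_commutes
            power_mult[symmetric] mult.commute[of n 2])
      finally show "?V n / (\<Lambda> ^ n)\<^sup>2 \<le> real ((k + 1) ^ k) * (\<Sum>I\<in>Pow {..<k} - {{}}. (?D I / \<Lambda>\<^sup>2) ^ n)" .
    qed
    have "?D I / \<Lambda>\<^sup>2 < 1" if "I \<in> Pow {..<k} - {{}}" for I
      using pair_cycle_sum_less[OF assms(1-4) _ _ lam, of I] that L0 by (simp add: \<Lambda>_def)
    then have "(\<lambda>n. real ((k + 1) ^ k) * (\<Sum>I\<in>Pow {..<k} - {{}}. (?D I / \<Lambda>\<^sup>2) ^ n)) \<longlonglongrightarrow>
        real ((k + 1) ^ k) * (\<Sum>I\<in>Pow {..<k} - {{}}. 0)"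
      using D0 L0 by (intro tendsto_intros LIMSEQ_power_zero) auto
    then show "(\<lambda>n. real ((k + 1) ^ k) * (\<Sum>I\<in>Pow {..<k} - {{}}. (?D I / \<Lambda>\<^sup>2) ^ n)) \<longlonglongrightarrow> 0"
      by simp
  qed simp
qed

text \<open>First moment method: the count is an integer, so the indicator of its being nonzero is
  at most the count itself, whose mean tends to 0.\<close>

lemma aas_no_cycle:
  assumes "0 < \<alpha>" "\<alpha> < 1" "0 < \<beta>" "\<beta> < 1" "3 \<le> k"
    and lam: "(\<alpha> + \<beta>) ^ k + (\<alpha> - \<beta>) ^ k < 1"
  shows "aas (\<lambda>n. kronecker_graph n (initiator \<alpha> \<beta> \<alpha>)) (\<lambda>n E. cycle_copies k n E = {})"
  unfolding aas_def
proof (rule tendsto_sandwich)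
  define \<Lambda> where "\<Lambda> = (\<alpha> + \<beta>) ^ k + (\<alpha> - \<beta>) ^ k"
  let ?M = "\<lambda>n. kronecker_graph n (initiator \<alpha> \<beta> \<alpha>)"
  have L: "0 \<le> \<Lambda>" "\<Lambda> < 1" using lam power_sum_diff_nonneg[of \<alpha> \<beta> k] assms by (auto simp: \<Lambda>_def)
  show "\<forall>\<^sub>F n in sequentially. 1 - \<Lambda> ^ n \<le> measure_pmf.prob (?M n) {E. cycle_copies k n E = {}}"
  proof (intro always_eventually allI)
    fix n
    have fin: "finite (cycle_copies k n E)" for E
      by (rule finite_subset[OF _ finite_cycle_embeddings[of k n]]) (auto simp: cycle_copies_eq)
    have "measure_pmf.prob (?M n) {E. cycle_copies k n E \<noteq> {}}
        = measure_pmf.expectation (?M n) (\<lambda>E. of_bool (cycle_copies k n E \<noteq> {}))"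
      by (simp only: expectation_of_bool)
    also have "\<dots> \<le> measure_pmf.expectation (?M n) (\<lambda>E. real (card (cycle_copies k n E)))"
    proof (rule integral_mono)
      show "of_bool (cycle_copies k n E \<noteq> {}) \<le> real (card (cycle_copies k n E))" for E
        using fin[of E] by (auto simp: Suc_le_eq card_gt_0_iff)
    qed (rule integrable_measure_pmf_finite[OF finite_set_kronecker_graph])+
    also have "\<dots> \<le> \<Lambda> ^ n" unfolding \<Lambda>_def by (rule expectation_cycle_copies_le[OF assms(1-5)])
    finally have "measure_pmf.prob (?M n) {E. cycle_copies k n E \<noteq> {}} \<le> \<Lambda> ^ n" .
    moreover have "measure_pmf.prob (?M n) {E. cycle_copies k n E \<noteq> {}} =
        1 - measure_pmf.prob (?M n) {E. cycle_copies k n E = {}}"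
      using measure_pmf.prob_compl[of "{E. cycle_copies k n E = {}}" "?M n"]
      by (simp add: Collect_neg_eq Compl_eq_Diff_UNIV)
    ultimately show "1 - \<Lambda> ^ n \<le> measure_pmf.prob (?M n) {E. cycle_copies k n E = {}}" by linarith
  qed
  show "(\<lambda>n. 1 - \<Lambda> ^ n) \<longlonglongrightarrow> 1"
    using tendsto_diff[OF tendsto_const[of 1] LIMSEQ_power_zero[of \<Lambda>]] L by simp
qed auto

theorem theorem3:
  fixes \<alpha> \<beta> \<gamma> :: real and k :: nat
  assumes "0 < \<alpha>" "\<alpha> < 1" "0 < \<beta>" "\<beta> < 1" "0 < \<gamma>" "\<gamma> < 1"
    and "\<alpha> = \<gamma>"
    and "k \<ge> 3"
  shows "((\<alpha> + \<beta>) ^ k + (\<alpha> - \<beta>) ^ k < 1 \<longrightarrow>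
            aas (\<lambda>n. kronecker_graph n (initiator \<alpha> \<beta> \<gamma>)) (\<lambda>n E. cycle_copies k n E = {})) \<and>
         ((\<alpha> + \<beta>) ^ k + (\<alpha> - \<beta>) ^ k > 1 \<longrightarrow>
            (\<exists>\<delta> :: nat \<Rightarrow> real. \<delta> \<longlonglongrightarrow> 0 \<and>
               aas (\<lambda>n. kronecker_graph n (initiator \<alpha> \<beta> \<gamma>))
                 (\<lambda>n E. \<exists>\<eta> :: real. \<bar>\<eta>\<bar> \<le> \<delta> n \<and>
                    real (card (cycle_copies k n E)) =
                      (1 + \<eta>) * ((\<alpha> + \<beta>) ^ k + (\<alpha> - \<beta>) ^ k) ^ n)))"
  unfolding \<open>\<alpha> = \<gamma>\<close>[symmetric]
proof (intro conjI impI)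
  assume "(\<alpha> + \<beta>) ^ k + (\<alpha> - \<beta>) ^ k < 1"
  then show "aas (\<lambda>n. kronecker_graph n (initiator \<alpha> \<beta> \<alpha>)) (\<lambda>n E. cycle_copies k n E = {})"
    using assms by (intro aas_no_cycle)
next
  assume lam: "1 < (\<alpha> + \<beta>) ^ k + (\<alpha> - \<beta>) ^ k"
  have "0 < (\<alpha> + \<beta>) ^ k + (\<alpha> - \<beta>) ^ k" using lam by linarith
  then show "\<exists>\<delta> :: nat \<Rightarrow> real. \<delta> \<longlonglongrightarrow> 0 \<and>
      aas (\<lambda>n. kronecker_graph n (initiator \<alpha> \<beta> \<alpha>))
        (\<lambda>n E. \<exists>\<eta> :: real. \<bar>\<eta>\<bar> \<le> \<delta> n \<and>
          real (card (cycle_copies k n E)) = (1 + \<eta>) * ((\<alpha> + \<beta>) ^ k + (\<alpha> - \<beta>) ^ k) ^ n)"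
    using assms(1-4,8) lam
    by (intro aas_of_variance finite_set_kronecker_graph zero_less_power
        expectation_cycle_copies_asymp variance_cycle_copies_asymp)
qed

end
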